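(* Let $U,V,W$ be objects of $C_2\mathcal J_{0,0}$ and let $X=\mathbb R$ or $X=\mathbb R^\delta$. The homotopy cofibre of the (restricted composition) map $$C_2\mathcal J_{W}(U\oplus X,V)\wedge S^{W\otimes X}\rightarrow C_2\mathcal J_{W}(U,V)$$ is $C_2$-homeomorphic to $C_2\mathcal J_{W\oplus X}(U,V)$.
   Context: $C_2=\{e,\sigma\}$; $\mathbb R$ and $\mathbb R^\delta$ are the trivial and sign $C_2$-representations. Objects of $C_2\mathcal J_{0,0}$ are finite-dimensional $C_2$-subrepresentations, with invariant inner product, of $\bigoplus_{i=1}^\infty\mathbb R[C_2]$ (up to isomorphism, arbitrary finite-dimensional orthogonal $C_2$-representations; direct sums and tensor products have the diagonal action). $\mathcal L(U,V)$ is the space of all linear isometries $U\to V$ (not necessarily equivariant or surjective) with $C_2$-action $\sigma*f=\sigma f\sigma$. For an object $W$, $$C_2\gamma_W(U,V)=\{(f,x):f\in\mathcal L(U,V),\ x\in W\otimes f(U)^\perp\}$$ is a vector bundle over $\mathcal L(U,V)$ with $C_2$-action $\sigma(f,x)=(\sigma*f,\sigma x)$, and $C_2\mathcal J_W(U,V)$ is its Thom space (the one-point compactification of the total space), a pointed $C_2$-space. There are composition maps $C_2\mathcal J_W(V,Y)\wedge C_2\mathcal J_W(U,V)\to C_2\mathcal J_W(U,Y)$ induced by $((f,x),(g,y))\mapsto(fg,x+(\mathrm{id}\otimes f)(y))$. $S^{W\otimes X}$ is the one-point compactification of $W\otimes X$; it is identified $C_2$-equivariantly with a subspace of $C_2\mathcal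 J_W(U,U\oplus X)$ via $w\otimes y\mapsto(i_U,w\otimes(0,y))$, where $i_U(u)=(u,0)$. The restricted composition map is thus $(f,x)\wedge(w\otimes y)\mapsto(f|_U,\ x+(\mathrm{id}_W\otimes f|_X)(w\otimes y))$. The homotopy cofibre is the (reduced) mapping cone, with cone parameter in $[0,\infty]$, $C_2$ acting trivially on the parameter. *)

theory Defs
  imports "HOL-Analysis.Analysis"
begin

section \<open>Orthogonal representations of the group of order two\<close>

text \<open>A representation is a subspace of a Euclidean space together with the action of the
  generator \<open>\<sigma>\<close>; the action is given on the ambient space, of which the carrier is
  a subrepresentation. Carriers are subspaces, not types, because the class
  \<open>euclidean_space\<close> excludes the zero space.\<close>

record 'a c2rep =
  carr :: "'a set"
  act :: "'a \<Rightarrow> 'a"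

definition c2_rep :: "'a::euclidean_space c2rep \<Rightarrow> bool" where
  "c2_rep U \<longleftrightarrow> subspace (carr U) \<and> orthogonal_transformation (act U) \<and>
     (\<forall>u. act U (act U u) = u) \<and> act U ` carr U \<subseteq> carr U"

definition triv_rep :: "real c2rep" where
  "triv_rep = \<lparr>carr = UNIV, act = (\<lambda>x. x)\<rparr>"

definition sign_rep :: "real c2rep" where
  "sign_rep = \<lparr>carr = UNIV, act = uminus\<rparr>"

definition rep_sum :: "'a c2rep \<Rightarrow> 'b c2rep \<Rightarrow> ('a \<times> 'b) c2rep" where
  "rep_sum U X = \<lparr>carr = carr U \<times> carr X, act = map_prod (act U) (act X)\<rparr>"


section \<open>Tensor products\<close>

text \<open>The tensor product of two Euclidean spaces is realised as the space of linear maps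
  between them, \<open>w \<otimes> v\<close> being the rank-one map \<open>z \<mapsto> \<langle>w, z\<rangle> v\<close>. Lemma \<open>tens_universal\<close> is
  the universal property.\<close>

definition tens :: "'w::euclidean_space \<Rightarrow> 'v::euclidean_space \<Rightarrow> 'w \<Rightarrow>\<^sub>L 'v" where
  "tens w v = Blinfun (\<lambda>z. (w \<bullet> z) *\<^sub>R v)"

definition tens_space ::
  "'w::euclidean_space set \<Rightarrow> 'v::euclidean_space set \<Rightarrow> ('w \<Rightarrow>\<^sub>L 'v) set" where
  "tens_space S T = span {tens w v | w v. w \<in> S \<and> v \<in> T}"

text \<open>The map \<open>A \<otimes> B\<close>; see \<open>tens_map_tens\<close>.\<close>

definition tens_map ::
  "('w::euclidean_space \<Rightarrow> 'x::euclidean_space) \<Rightarrow> ('v::euclidean_space \<Rightarrow> 'y::euclidean_space)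
    \<Rightarrow> ('w \<Rightarrow>\<^sub>L 'v) \<Rightarrow> ('x \<Rightarrow>\<^sub>L 'y)" where
  "tens_map A B t = Blinfun (\<lambda>z. B (t (adjoint A z)))"

definition tens_rep ::
  "'w::euclidean_space c2rep \<Rightarrow> 'v::euclidean_space c2rep \<Rightarrow> ('w \<Rightarrow>\<^sub>L 'v) c2rep" where
  "tens_rep W X = \<lparr>carr = tens_space (carr W) (carr X), act = tens_map (act W) (act X)\<rparr>"

lemma tens_apply: "blinfun_apply (tens w v) z = (w \<bullet> z) *\<^sub>R v"
  unfolding tens_def
  by (subst bounded_linear_Blinfun_apply)
    (auto intro!: bounded_linear_intros)

lemma tens_bilinear: "bilinear (tens :: 'w::euclidean_space \<Rightarrow> 'v::euclidean_space \<Rightarrow> _)"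
  unfolding bilinear_def
  by (auto intro!: linearI blinfun_eqI
      simp: tens_apply blinfun.bilinear_simps inner_add_left scaleR_add_left scaleR_add_right)

lemma tens_expansion:
  fixes t :: "'w::euclidean_space \<Rightarrow>\<^sub>L 'v::euclidean_space"
  shows "t = (\<Sum>b\<in>Basis. tens b (t b))"
proof (rule blinfun_eqI)
  fix z
  have "t z = t (\<Sum>b\<in>Basis. (z \<bullet> b) *\<^sub>R b)"
    by (simp add: euclidean_representation)
  also have "\<dots> = blinfun_apply (\<Sum>b\<in>Basis. tens b (t b)) z"
    by (simp add: blinfun.sum_right blinfun.sum_left blinfun.scaleR_right tens_apply
        inner_commute)
  finally show "blinfun_apply t z = blinfun_apply (\<Sum>b\<in>Basis. tens b (t b)) z" .
qed

lemma tens_universal: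
  fixes h :: "'w::euclidean_space \<Rightarrow> 'v::euclidean_space \<Rightarrow> 'c::real_vector"
  assumes h: "bilinear h"
  shows "\<exists>!H. linear H \<and> (\<forall>w v. H (tens w v) = h w v)"
proof (rule ex_ex1I)
  have l1: "linear (\<lambda>w. h w v)" and l2: "linear (h w)" for w v
    using h by (auto simp: bilinear_def)
  let ?H = "\<lambda>t::'w \<Rightarrow>\<^sub>L 'v. \<Sum>b\<in>Basis. h b (blinfun_apply t b)"
  have "linear ?H"
    by (rule linearI) (simp_all add: blinfun.bilinear_simps linear_add[OF l2] linear_scale[OF l2]
        sum.distrib scaleR_right.sum)
  moreover have "?H (tens w v) = h w v" for w v
  proof -
    have "h w v = h (\<Sum>b\<in>Basis. (w \<bullet> b) *\<^sub>R b) v"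
      by (simp add: euclidean_representation)
    also have "\<dots> = (\<Sum>b\<in>Basis. (w \<bullet> b) *\<^sub>R h b v)"
      by (simp add: linear_sum[OF l1] linear_scale[OF l1])
    finally show ?thesis
      by (simp add: tens_apply linear_scale[OF l2])
  qed
  ultimately show "\<exists>H. linear H \<and> (\<forall>w v. H (tens w v) = h w v)"
    by blast
next
  fix H K :: "('w \<Rightarrow>\<^sub>L 'v) \<Rightarrow> 'c"
  assume H: "linear H \<and> (\<forall>w v. H (tens w v) = h w v)"
    and K: "linear K \<and> (\<forall>w v. K (tens w v) = h w v)"
  show "H = K"
  proof
    fix t :: "'w \<Rightarrow>\<^sub>L 'v"
    have "H (\<Sum>b\<in>Basis. tens b (t b)) = K (\<Sum>b\<in>Basis. tens b (t b))"
      using H K by (simp add: linear_sum)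
    then show "H t = K t"
      by (metis tens_expansion)
  qed
qed

lemma tens_map_apply:
  fixes A :: "'w::euclidean_space \<Rightarrow> 'x::euclidean_space"
    and B :: "'v::euclidean_space \<Rightarrow> 'y::euclidean_space"
  assumes "linear A" "linear B"
  shows "blinfun_apply (tens_map A B t) z = B (t (adjoint A z))"
proof -
  have "linear (\<lambda>z. B (blinfun_apply t (adjoint A z)))"
    using linear_compose[OF linear_compose[OF adjoint_linear[OF assms(1)]
        bounded_linear.linear[OF blinfun.bounded_linear_right[of t]]] assms(2)]
    by (simp add: o_def)
  then show ?thesis
    unfolding tens_map_def
    by (simp add: bounded_linear_Blinfun_apply linear_conv_bounded_linear)
qed

lemma tens_map_tens:
  fixes A :: "'w::euclidean_space \<Rightarrow> 'x::euclidean_space"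
    and B :: "'v::euclidean_space \<Rightarrow> 'y::euclidean_space"
  assumes "linear A" "linear B"
  shows "tens_map A B (tens w v) = tens (A w) (B v)"
  by (rule blinfun_eqI)
    (simp add: tens_map_apply assms tens_apply linear_scale adjoint_works)

lemma tens_map_linear:
  fixes A :: "'w::euclidean_space \<Rightarrow> 'x::euclidean_space"
    and B :: "'v::euclidean_space \<Rightarrow> 'y::euclidean_space"
  assumes "linear A" "linear B"
  shows "linear (tens_map A B)"
  by (rule linearI)
    (auto intro!: blinfun_eqI simp: tens_map_apply assms blinfun.bilinear_simps
      linear_add linear_scale)


section \<open>Linear isometries\<close>

text \<open>A linear map on a subspace \<open>S\<close> is represented by its extension by zero on the
  orthogonal complement of \<open>S\<close>, so that distinct maps on \<open>S\<close> have distinct representatives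
  and the operator norm topology is the usual one.\<close>

definition lin_iso ::
  "'u::euclidean_space c2rep \<Rightarrow> 'v::euclidean_space c2rep \<Rightarrow> ('u \<Rightarrow>\<^sub>L 'v) set" where
  "lin_iso U V = {f :: 'u \<Rightarrow>\<^sub>L 'v. (\<forall>u\<in>carr U. f u \<in> carr V \<and> norm (f u) = norm u) \<and>
                     (\<forall>u\<in>orthogonal_comp (carr U). f u = 0)}"

definition ext0 ::
  "'u::euclidean_space set \<Rightarrow> ('u \<Rightarrow> 'v::euclidean_space) \<Rightarrow> 'u \<Rightarrow>\<^sub>L 'v" where
  "ext0 S f = (THE g. (\<forall>u\<in>S. blinfun_apply g u = f u) \<and>
                      (\<forall>u\<in>orthogonal_comp S. blinfun_apply g u = 0))"

lemma ext0_unique_exists: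
  fixes f :: "'u::euclidean_space \<Rightarrow> 'v::euclidean_space"
  assumes S: "subspace S" and f: "linear f"
  shows "\<exists>!g. (\<forall>u\<in>S. blinfun_apply g u = f u) \<and>
              (\<forall>u\<in>orthogonal_comp S. blinfun_apply g u = 0)"
proof (rule ex_ex1I)
  obtain B where B: "B \<subseteq> S" "pairwise orthogonal B" "\<And>x. x \<in> B \<Longrightarrow> norm x = 1"
      "independent B" "span B = S"
    using orthonormal_basis_subspace[OF S] by metis
  have fin: "finite B" using B(4) by (rule independent_imp_finite)
  let ?p = "\<lambda>u. \<Sum>b\<in>B. (u \<bullet> b) *\<^sub>R b"
  have lp: "linear ?p"
    by (rule linearI) (simp_all add: inner_add_left scaleR_add_left sum.distrib scaleR_right.sum)
  have id: "?p u = u" if "u \<in> S" for u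
  proof (rule linear_eq_on_span[of ?p "\<lambda>u. u" B u])
    show "?p c = c" if c: "c \<in> B" for c
    proof -
      have "?p c = (\<Sum>b\<in>B. if b = c then c else 0)"
      proof (rule sum.cong[OF refl])
        fix b assume "b \<in> B"
        then show "(c \<bullet> b) *\<^sub>R b = (if b = c then c else 0)"
          using B(2) B(3)[OF c] c
          by (auto simp: pairwise_def orthogonal_def norm_eq_1)
      qed
      then show ?thesis using fin c by simp
    qed
  qed (use lp B(5) that in \<open>auto intro: linear_ident\<close>)
  have "linear (\<lambda>u. f (?p u))"
    using linear_compose[OF lp f] by (simp add: o_def)
  then have ap: "blinfun_apply (Blinfun (\<lambda>u. f (?p u))) u = f (?p u)" for u
    by (simp add: bounded_linear_Blinfun_apply linear_conv_bounded_linear)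
  have "?p u = 0" if "u \<in> orthogonal_comp S" for u
  proof (rule sum.neutral, rule ballI)
    fix b assume "b \<in> B"
    then have "b \<bullet> u = 0"
      using that B(1) unfolding orthogonal_comp_def orthogonal_def by blast
    then show "(u \<bullet> b) *\<^sub>R b = 0" by (simp add: inner_commute)
  qed
  then show "\<exists>g. (\<forall>u\<in>S. blinfun_apply g u = f u) \<and>
                 (\<forall>u\<in>orthogonal_comp S. blinfun_apply g u = 0)"
    by (intro exI[of _ "Blinfun (\<lambda>u. f (?p u))"]) (simp add: ap id linear_0[OF f])
next
  fix g h :: "'u \<Rightarrow>\<^sub>L 'v"
  assume g: "(\<forall>u\<in>S. blinfun_apply g u = f u) \<and> (\<forall>u\<in>orthogonal_comp S. blinfun_apply g u = 0)"
    and h: "(\<forall>u\<in>S. blinfun_apply h u = f u) \<and> (\<forall>u\<in>orthogonal_comp S. blinfun_apply h u = 0)"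
  show "g = h"
  proof (rule blinfun_eqI)
    fix u
    have "u \<in> S + orthogonal_comp S"
      using subspace_sum_orthogonal_comp[OF S] by simp
    then obtain a b where "a \<in> S" "b \<in> orthogonal_comp S" "u = a + b"
      by (rule set_plus_elim)
    then show "blinfun_apply g u = blinfun_apply h u"
      using g h by (simp add: blinfun.add_right)
  qed
qed


section \<open>Pointed spaces with an action of the group of order two\<close>

record 'a c2space =
  ctop :: "'a topology"
  cbase :: 'a
  cact :: "'a \<Rightarrow> 'a"

definition c2_homeomorphic :: "'a c2space \<Rightarrow> 'b c2space \<Rightarrow> bool" where
  "c2_homeomorphic A B \<longleftrightarrow>
     (\<exists>h. homeomorphic_map (ctop A) (ctop B) h \<and> h (cbase A) = cbase B \<and>
          (\<forall>a\<in>topspace (ctop A). h (cact A a) = cact B (h a)))"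

text \<open>The quotient of a space by the equivalence relation generated by \<open>r\<close>.\<close>

definition eq_class :: "('a \<times> 'a) set \<Rightarrow> 'a \<Rightarrow> 'a set" where
  "eq_class r x = (r \<union> r\<inverse>)\<^sup>* `` {x}"

definition quotient_top :: "'a topology \<Rightarrow> ('a \<times> 'a) set \<Rightarrow> 'a set topology" where
  "quotient_top T r = topology (\<lambda>S. S \<subseteq> eq_class r ` topspace T \<and>
                                    openin T {x \<in> topspace T. eq_class r x \<in> S})"

lemma openin_quotient_top:
  "openin (quotient_top T r) S \<longleftrightarrow>
     S \<subseteq> eq_class r ` topspace T \<and> openin T {x \<in> topspace T. eq_class r x \<in> S}"
proof -
  let ?O = "\<lambda>S. S \<subseteq> eq_class r ` topspace T \<and> openin T {x \<in> topspace T. eq_class r x \<in> S}"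
  have "istopology ?O"
    unfolding istopology_def
  proof (intro conjI allI impI)
    fix A B assume "?O A" "?O B"
    moreover have "{x \<in> topspace T. eq_class r x \<in> A \<inter> B} =
        {x \<in> topspace T. eq_class r x \<in> A} \<inter> {x \<in> topspace T. eq_class r x \<in> B}" by auto
    ultimately show "A \<inter> B \<subseteq> eq_class r ` topspace T"
      "openin T {x \<in> topspace T. eq_class r x \<in> A \<inter> B}"
      by auto
  next
    fix K assume K: "\<forall>S\<in>K. ?O S"
    have "{x \<in> topspace T. eq_class r x \<in> \<Union>K} =
        (\<Union>S\<in>K. {x \<in> topspace T. eq_class r x \<in> S})" by auto
    then show "openin T {x \<in> topspace T. eq_class r x \<in> \<Union>K}"
      using K by auto
    show "\<Union>K \<subseteq> eq_class r ` topspace T" using K by blast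
  qed
  then show ?thesis
    unfolding quotient_top_def by (simp add: topology_inverse')
qed

lemma quotient_map_eq_class: "quotient_map T (quotient_top T r) (eq_class r)"
proof -
  have "openin (quotient_top T r) (eq_class r ` topspace T)"
  proof -
    have "{x \<in> topspace T. eq_class r x \<in> eq_class r ` topspace T} = topspace T" by auto
    then show ?thesis by (simp add: openin_quotient_top)
  qed
  then have "topspace (quotient_top T r) = eq_class r ` topspace T"
    unfolding topspace_def[of "quotient_top T r"] by (auto simp: openin_quotient_top)
  then show ?thesis
    by (auto simp: quotient_map_def openin_quotient_top)
qed

definition disj_sum_top :: "'a topology \<Rightarrow> 'b topology \<Rightarrow> ('a + 'b) topology" where
  "disj_sum_top S T = topology (\<lambda>D. openin S (Inl -` D) \<and> openin T (Inr -` D))"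

lemma openin_disj_sum_top:
  "openin (disj_sum_top S T) D \<longleftrightarrow> openin S (Inl -` D) \<and> openin T (Inr -` D)"
proof -
  have "istopology (\<lambda>D. openin S (Inl -` D) \<and> openin T (Inr -` D))"
    unfolding istopology_def by (auto simp: vimage_Union)
  then show ?thesis
    unfolding disj_sum_top_def by (simp add: topology_inverse')
qed

definition smash :: "'a c2space \<Rightarrow> 'b c2space \<Rightarrow> ('a \<times> 'b) set c2space" where
  "smash A B =
     (let r = {(p, (cbase A, cbase B)) | p. p \<in> topspace (prod_topology (ctop A) (ctop B)) \<and>
                 (fst p = cbase A \<or> snd p = cbase B)}
      in \<lparr>ctop = quotient_top (prod_topology (ctop A) (ctop B)) r,
          cbase = eq_class r (cbase A, cbase B),
          cact = (\<lambda>c. map_prod (cact A) (cact B) ` c)\<rparr>)"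

text \<open>The reduced mapping cone: \<open>A \<times> [0,\<infinity>]\<close> glued to \<open>B\<close> along \<open>f\<close> at parameter \<open>0\<close>, with
  \<open>A \<times> {\<infinity>}\<close> and \<open>{*} \<times> [0,\<infinity>]\<close> collapsed to the base point. The type \<open>ennreal\<close> is the
  closed interval \<open>[0,\<infinity>]\<close>.\<close>

definition mapping_cone ::
  "'a c2space \<Rightarrow> 'b c2space \<Rightarrow> ('a \<Rightarrow> 'b) \<Rightarrow> ('a \<times> ennreal + 'b) set c2space" where
  "mapping_cone A B f =
     (let r = {(Inl (a, 0), Inr (f a)) | a. a \<in> topspace (ctop A)}
            \<union> {(Inl (a, \<infinity>), Inr (cbase B)) | a. a \<in> topspace (ctop A)}
            \<union> {(Inl (cbase A, t), Inr (cbase B)) | t. True}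
      in \<lparr>ctop = quotient_top (disj_sum_top (prod_topology (ctop A) euclidean) (ctop B)) r,
          cbase = eq_class r (Inr (cbase B)),
          cact = (\<lambda>c. map_sum (map_prod (cact A) (\<lambda>t. t)) (cact B) ` c)\<rparr>)"


section \<open>Thom spaces\<close>

text \<open>\<open>Alexandroff_compactification\<close> always adds a point \<open>None\<close>, also to a compact or empty
  space, which is the convention needed for Thom spaces over a compact base.\<close>

definition rep_sphere :: "'a::topological_space c2rep \<Rightarrow> 'a option c2space" where
  "rep_sphere Z = \<lparr>ctop = Alexandroff_compactification (top_of_set (carr Z)),
                   cbase = None, cact = map_option (act Z)\<rparr>"

definition gamma_bundle ::
  "'w::euclidean_space c2rep \<Rightarrow> 'u::euclidean_space c2rep \<Rightarrow> 'v::euclidean_space c2rep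
    \<Rightarrow> (('u \<Rightarrow>\<^sub>L 'v) \<times> ('w \<Rightarrow>\<^sub>L 'v)) set" where
  "gamma_bundle W U V =
     {(f, x). f \<in> lin_iso U V \<and>
              x \<in> tens_space (carr W) (carr V \<inter> orthogonal_comp (blinfun_apply f ` carr U))}"

definition conj_act ::
  "'u::euclidean_space c2rep \<Rightarrow> 'v::euclidean_space c2rep \<Rightarrow> ('u \<Rightarrow>\<^sub>L 'v) \<Rightarrow> ('u \<Rightarrow>\<^sub>L 'v)" where
  "conj_act U V f = Blinfun (\<lambda>u. act V (f (act U u)))"

definition J ::
  "'w::euclidean_space c2rep \<Rightarrow> 'u::euclidean_space c2rep \<Rightarrow> 'v::euclidean_space c2rep
    \<Rightarrow> (('u \<Rightarrow>\<^sub>L 'v) \<times> ('w \<Rightarrow>\<^sub>L 'v)) option c2space" where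
  "J W U V = \<lparr>ctop = Alexandroff_compactification (top_of_set (gamma_bundle W U V)),
              cbase = None,
              cact = map_option (map_prod (conj_act U V) (tens_map (act W) (act V)))\<rparr>"

definition J_comp ::
  "(('v::euclidean_space \<Rightarrow>\<^sub>L 'y::euclidean_space) \<times> ('w::euclidean_space \<Rightarrow>\<^sub>L 'y)) option
    \<Rightarrow> (('u::euclidean_space \<Rightarrow>\<^sub>L 'v) \<times> ('w \<Rightarrow>\<^sub>L 'v)) option
    \<Rightarrow> (('u \<Rightarrow>\<^sub>L 'y) \<times> ('w \<Rightarrow>\<^sub>L 'y)) option" where
  "J_comp p q = (case (p, q) of
       (Some (f, x), Some (g, y)) \<Rightarrow>
          Some (f o\<^sub>L g, x + tens_map (\<lambda>w. w) (blinfun_apply f) y)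
     | _ \<Rightarrow> None)"

text \<open>The inclusion of the sphere of \<open>W \<otimes> X\<close> into \<open>J W U (rep_sum U X)\<close>, given by
  \<open>w \<otimes> y \<mapsto> (i\<^sub>U, w \<otimes> (0, y))\<close>.\<close>

definition sphere_incl ::
  "'u::euclidean_space c2rep \<Rightarrow> ('w::euclidean_space \<Rightarrow>\<^sub>L 'x::euclidean_space) option
    \<Rightarrow> (('u \<Rightarrow>\<^sub>L ('u \<times> 'x)) \<times> ('w \<Rightarrow>\<^sub>L ('u \<times> 'x))) option" where
  "sphere_incl U = map_option
     (\<lambda>z. (ext0 (carr U) (\<lambda>u. (u, 0)), tens_map (\<lambda>w. w) (\<lambda>y. (0, y)) z))"

text \<open>The map induced on the smash product; \<open>the_elem\<close> reads off the common value on an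
  equivalence class of pairs.\<close>

definition restricted_comp ::
  "'u::euclidean_space c2rep
    \<Rightarrow> (((('u \<times> 'x::euclidean_space) \<Rightarrow>\<^sub>L 'v::euclidean_space) \<times> ('w::euclidean_space \<Rightarrow>\<^sub>L 'v)) option
        \<times> ('w \<Rightarrow>\<^sub>L 'x) option) set
    \<Rightarrow> (('u \<Rightarrow>\<^sub>L 'v) \<times> ('w \<Rightarrow>\<^sub>L 'v)) option" where
  "restricted_comp U c = the_elem ((\<lambda>(p, q). J_comp p (sphere_incl U q)) ` c)"

end

theory Submission
  imports Defs
begin

text \<open>
  A point of the Thom space of \<open>W \<oplus> X\<close> over \<open>L(U, V)\<close> is a triple of an isometry \<open>f\<close>, an
  element \<open>x'\<close> of \<open>W \<otimes> f(U)\<bottom>\<close> and, as \<open>X\<close> is a line, a vector \<open>y\<close> of \<open>f(U)\<bottom>\<close>. Where \<open>y = 0\<close> this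
  is a point of the Thom space of \<open>W\<close>. Where \<open>y \<noteq> 0\<close>, write \<open>y = t v\<close> with \<open>t > 0\<close> and \<open>v\<close> a unit
  vector: then \<open>f\<close> and \<open>v\<close> together are an isometry \<open>g\<close> on \<open>U \<oplus> X\<close>, and \<open>x'\<close> splits orthogonally as
  \<open>x + w \<otimes> v\<close> with \<open>x\<close> in \<open>W \<otimes> g(U \<oplus> X)\<bottom>\<close> and \<open>w\<close> in \<open>W \<otimes> X\<close>. The coordinates \<open>((g, x), w, t)\<close> are those
  of the cone, and letting \<open>t\<close> tend to \<open>0\<close> gives \<open>(f, x + w \<otimes> v)\<close>, which is the value of the
  composition map. If any of \<open>x\<close>, \<open>w\<close>, \<open>t\<close> tends to infinity then so does \<open>(x', y)\<close>, so the points
  at infinity match the points which the cone and the smash product collapse.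

  The proof therefore has two independent parts. Topologically
  (\<open>mapping_cone_smash_Alexandroff\<close>), a proper map on \<open>P \<times> B \<times> [0, \<infinity>)\<close> that parametrises the
  complement of a closed subspace \<open>Y\<close> of \<open>Z\<close> by the points with positive parameter, and maps the face
  \<open>t = 0\<close> into \<open>Y\<close>, exhibits \<open>Z\<^sup>+\<close> as the mapping cone of \<open>P\<^sup>+ \<and> B\<^sup>+ \<rightarrow> Y\<^sup>+\<close>; all spaces being
  compact and the target Hausdorff, a continuous bijection suffices. Geometrically
  (\<open>inj_on_polar_map\<close>, \<open>polar_map_disjoint\<close>, \<open>polar_map_cover\<close>, \<open>norm_polar_map_ge\<close>), the map
  \<open>((g, x), w, t) \<mapsto> (g|U, x + w \<otimes> g(0, 1), t g(0, 1))\<close> has these properties. It is equivariant for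
  both actions on \<open>X\<close> (\<open>polar_map_equivariant\<close>), with \<open>\<sigma>\<close> fixing \<open>t\<close>.
\<close>

section \<open>Quotients by generated equivalence relations\<close>

lemma eq_class_eqI:
  assumes "(x, y) \<in> r"
  shows "eq_class r x = eq_class r y"
proof -
  have "(x, y) \<in> (r \<union> r\<inverse>)\<^sup>*" "(y, x) \<in> (r \<union> r\<inverse>)\<^sup>*"
    using assms by auto
  then show ?thesis
    unfolding eq_class_def by (auto intro: rtrancl_trans)
qed

lemma constant_on_eq_class:
  assumes "\<And>x y. (x, y) \<in> r \<Longrightarrow> F x = F y" and "y \<in> eq_class r x"
  shows "F y = F x"
proof -
  have "(x, y) \<in> (r \<union> r\<inverse>)\<^sup>*"
    using assms(2) by (simp add: eq_class_def)
  then show ?thesis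
    by induction (auto dest: assms(1))
qed

lemma self_in_eq_class: "x \<in> eq_class r x"
  by (simp add: eq_class_def)

lemma eq_class_subset:
  assumes "r \<subseteq> T \<times> T" and "x \<in> T"
  shows "eq_class r x \<subseteq> T"
proof
  fix y assume "y \<in> eq_class r x"
  then have "(x, y) \<in> (r \<union> r\<inverse>)\<^sup>*"
    by (simp add: eq_class_def)
  then show "y \<in> T"
    using assms by (induction rule: rtrancl_induct) auto
qed

lemma the_elem_image_eq_class:
  assumes "\<And>x y. (x, y) \<in> r \<Longrightarrow> F x = F y"
  shows "the_elem (F ` eq_class r x) = F x"
proof -
  have "F ` eq_class r x = (\<lambda>_. F x) ` eq_class r x"
    by (rule image_cong[OF refl]) (rule constant_on_eq_class[of r F, OF assms])
  also have "\<dots> = {F x}"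
    using self_in_eq_class[of x r] by (rule image_constant)
  finally show ?thesis by simp
qed

text \<open>Equivariance only has to be known on a set \<open>T\<close> containing the class: the action of
  \<open>\<sigma>\<close> on a quotient is the image map \<open>c \<mapsto> a ` c\<close>, and \<open>a\<close> need not carry classes onto classes
  outside the space.\<close>

lemma the_elem_equivariant:
  assumes r: "r \<subseteq> T \<times> T" and x: "x \<in> T"
    and F: "\<And>x y. (x, y) \<in> r \<Longrightarrow> F x = F y"
    and a: "\<And>y. y \<in> T \<Longrightarrow> F (a y) = \<rho> (F y)"
  shows "the_elem (F ` a ` eq_class r x) = \<rho> (F x)"
proof -
  have "F (a y) = \<rho> (F x)" if y: "y \<in> eq_class r x" for y
    using a[of y] subsetD[OF eq_class_subset[OF r x] y] constant_on_eq_class[of r F, OF F y] by simp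
  then have "F ` a ` eq_class r x = (\<lambda>_. \<rho> (F x)) ` eq_class r x"
    unfolding image_image by (rule image_cong[OF refl])
  also have "\<dots> = {\<rho> (F x)}"
    using self_in_eq_class[of x r] by (rule image_constant)
  finally show ?thesis by simp
qed

lemma topspace_quotient_top: "topspace (quotient_top T r) = eq_class r ` topspace T"
  using quotient_imp_surjective_map[OF quotient_map_eq_class] by (rule sym)

lemma compact_space_quotient_top: "compact_space T \<Longrightarrow> compact_space (quotient_top T r)"
  unfolding compact_space_def topspace_quotient_top
  using image_compactin quotient_imp_continuous_map[OF quotient_map_eq_class] by blast

text \<open>A continuous surjection from a compact space onto a Hausdorff space is a quotient map, so the
  target is the quotient by any relation that generates the kernel.\<close>

lemma homeomorphic_map_quotient_top:
  assumes Z: "compact_space Z" and Y: "Hausdorff_space Y"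
    and F: "continuous_map Z Y F" "F ` topspace Z = topspace Y"
    and r: "\<And>x y. (x, y) \<in> r \<Longrightarrow> F x = F y"
    and ker: "\<And>x y. x \<in> topspace Z \<Longrightarrow> y \<in> topspace Z \<Longrightarrow> F x = F y \<Longrightarrow> eq_class r x = eq_class r y"
  shows "homeomorphic_map (quotient_top Z r) Y (\<lambda>c. the_elem (F ` c))"
proof (rule continuous_imp_homeomorphic_map)
  have h: "the_elem (F ` eq_class r x) = F x" for x
    by (rule the_elem_image_eq_class) (rule r)
  have "continuous_map Z Y ((\<lambda>c. the_elem (F ` c)) \<circ> eq_class r)"
    using F(1) unfolding o_def h .
  then show "continuous_map (quotient_top Z r) Y (\<lambda>c. the_elem (F ` c))"
    by (rule continuous_compose_quotient_map[OF quotient_map_eq_class])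
  show "(\<lambda>c. the_elem (F ` c)) ` topspace (quotient_top Z r) = topspace Y"
    using F(2) unfolding topspace_quotient_top image_image h .
  show "inj_on (\<lambda>c. the_elem (F ` c)) (topspace (quotient_top Z r))"
    unfolding topspace_quotient_top
  proof (rule inj_onI, elim imageE)
    fix c d x y
    assume "the_elem (F ` c) = the_elem (F ` d)" "c = eq_class r x" "x \<in> topspace Z"
      "d = eq_class r y" "y \<in> topspace Z"
    then show "c = d"
      using ker[of x y] by (simp add: h)
  qed
qed (rule compact_space_quotient_top[OF Z] Y)+

section \<open>Disjoint sums and products\<close>

lemma topspace_disj_sum_top:
  "topspace (disj_sum_top S T) = Inl ` topspace S \<union> Inr ` topspace T"
proof
  have "Inl -` (Inl ` topspace S \<union> Inr ` topspace T) = topspace S"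
    "Inr -` (Inl ` topspace S \<union> Inr ` topspace T) = topspace T" by auto
  then have "openin (disj_sum_top S T) (Inl ` topspace S \<union> Inr ` topspace T)"
    by (simp add: openin_disj_sum_top)
  then show "Inl ` topspace S \<union> Inr ` topspace T \<subseteq> topspace (disj_sum_top S T)"
    by (rule openin_subset)
  have *: "openin S (Inl -` topspace (disj_sum_top S T))"
    "openin T (Inr -` topspace (disj_sum_top S T))"
    using openin_topspace[of "disj_sum_top S T"] unfolding openin_disj_sum_top by auto
  show "topspace (disj_sum_top S T) \<subseteq> Inl ` topspace S \<union> Inr ` topspace T"
  proof
    fix x assume "x \<in> topspace (disj_sum_top S T)"
    then show "x \<in> Inl ` topspace S \<union> Inr ` topspace T"
      using *[THEN openin_subset] by (cases x) auto
  qed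
qed

lemma continuous_map_disj_sum_top:
  assumes "continuous_map S Y (F \<circ> Inl)" and "continuous_map T Y (F \<circ> Inr)"
  shows "continuous_map (disj_sum_top S T) Y F"
  unfolding continuous_map_def
proof (intro conjI allI impI)
  show "F \<in> topspace (disj_sum_top S T) \<rightarrow> topspace Y"
    using assms by (auto simp: continuous_map_def topspace_disj_sum_top)
  fix B assume "openin Y B"
  then have "openin S {x \<in> topspace S. F (Inl x) \<in> B}" "openin T {x \<in> topspace T. F (Inr x) \<in> B}"
    using assms by (auto simp: continuous_map_def)
  moreover have "Inl -` {x \<in> topspace (disj_sum_top S T). F x \<in> B} = {x \<in> topspace S. F (Inl x) \<in> B}"
    "Inr -` {x \<in> topspace (disj_sum_top S T). F x \<in> B} = {x \<in> topspace T. F (Inr x) \<in> B}"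
    by (auto simp: topspace_disj_sum_top)
  ultimately show "openin (disj_sum_top S T) {x \<in> topspace (disj_sum_top S T). F x \<in> B}"
    unfolding openin_disj_sum_top by simp
qed

lemma compact_space_disj_sum_top:
  assumes "compact_space S" and "compact_space T"
  shows "compact_space (disj_sum_top S T)"
proof -
  have "{x \<in> topspace S. Inl x \<in> D} = Inl -` D" if "openin (disj_sum_top S T) D" for D
    using that openin_subset[of S "Inl -` D"] by (auto simp: openin_disj_sum_top)
  then have 1: "continuous_map S (disj_sum_top S T) Inl"
    unfolding continuous_map_def
    by (simp add: openin_disj_sum_top topspace_disj_sum_top)
  have "{x \<in> topspace T. Inr x \<in> D} = Inr -` D" if "openin (disj_sum_top S T) D" for D
    using that openin_subset[of T "Inr -` D"] by (auto simp: openin_disj_sum_top)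
  then have 2: "continuous_map T (disj_sum_top S T) Inr"
    unfolding continuous_map_def
    by (simp add: openin_disj_sum_top topspace_disj_sum_top)
  show ?thesis
    using assms 1 2 unfolding compact_space_def topspace_disj_sum_top
    by (intro compactin_Un image_compactin)
qed

lemma open_map_map_prod:
  assumes "open_map X X' f" and "open_map Y Y' g"
  shows "open_map (prod_topology X Y) (prod_topology X' Y') (map_prod f g)"
  unfolding open_map_def
proof (intro allI impI)
  fix D assume D: "openin (prod_topology X Y) D"
  show "openin (prod_topology X' Y') (map_prod f g ` D)"
    unfolding openin_prod_topology_alt
  proof (intro allI impI)
    fix a b assume "(a, b) \<in> map_prod f g ` D"
    then obtain x y where xy: "(x, y) \<in> D" "a = f x" "b = g y" by auto
    then obtain S T where "openin X S" "openin Y T" "x \<in> S" "y \<in> T" "S \<times> T \<subseteq> D"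
      using D unfolding openin_prod_topology_alt by meson
    moreover from this have "f ` S \<times> g ` T \<subseteq> map_prod f g ` D"
      by force
    ultimately show "\<exists>S T. openin X' S \<and> openin Y' T \<and> a \<in> S \<and> b \<in> T \<and> S \<times> T \<subseteq> map_prod f g ` D"
      using assms xy unfolding open_map_def by (metis imageI)
  qed
qed

lemma continuous_map_map_prod:
  assumes "continuous_map X X' f" and "continuous_map Y Y' g"
  shows "continuous_map (prod_topology X Y) (prod_topology X' Y') (map_prod f g)"
  unfolding map_prod_def using assms
  by (simp add: continuous_map_prod_top)

text \<open>The inverse \<open>enn2real\<close> is continuous below \<open>\<infinity>\<close>, so \<open>[0, \<infinity>)\<close> is an open subspace of
  \<open>[0, \<infinity>]\<close>.\<close>

lemma open_map_ennreal: "open_map (top_of_set {0..}) euclidean ennreal"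
  unfolding open_map_def
proof (intro allI impI)
  fix S :: "real set" assume "openin (top_of_set {0..}) S"
  then obtain T where T: "open T" "S = {0..} \<inter> T"
    by (auto simp: openin_open)
  have "continuous_on {..<top} enn2real"
    unfolding continuous_on_def
    by (auto intro!: tendsto_enn2real) 
  then have "open (enn2real -` T \<inter> {..<top})"
    using T(1) continuous_on_open_vimage open_lessThan by blast
  moreover have "ennreal ` S = enn2real -` T \<inter> {..<top}"
  proof (intro set_eqI iffI)
    fix x assume "x \<in> enn2real -` T \<inter> {..<top}"
    then show "x \<in> ennreal ` S"
      using T(2) by (intro image_eqI[of _ _ "enn2real x"]) auto
  qed (use T(2) in auto)
  ultimately show "openin euclidean (ennreal ` S)"
    by simp
qed

text \<open>Used for \<open>[0, \<infinity>]\<close>, whose topology is given by the order and not by a metric.\<close>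

lemma Hausdorff_space_t2: "Hausdorff_space (euclidean :: 'a::t2_space topology)"
  unfolding Hausdorff_space_def disjnt_def using hausdorff by (simp, metis)

lemma compact_space_ennreal: "compact_space (euclidean :: ennreal topology)"
  by (simp add: compact_space_def compact_UNIV)

section \<open>One-point compactifications\<close>

text \<open>One-point compactification is functorial for proper maps. Here it is combined with the
  collapse of a Hausdorff space \<open>K\<close> onto the compactification of an open subspace \<open>D\<close>: \<open>F\<close> sends
  everything outside \<open>D\<close> to the point at infinity. The preimage of a neighbourhood of infinity is
  the complement of the compact set \<open>e ` (\<phi>\<inverse> C)\<close>, and compact sets in \<open>K\<close> are closed. Applied to
  \<open>K\<close> the product \<open>P\<^sup>+ \<times> B\<^sup>+ \<times> [0, \<infinity>]\<close>, it avoids any separate discussion of neighbourhoods of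
  the points where some coordinate is infinite.\<close>

lemma continuous_map_into_Alexandroff:
  assumes K: "Hausdorff_space K"
    and e: "open_map D K e" "continuous_map D K e"
    and \<phi>: "continuous_map D Y \<phi>" "\<And>C. compactin Y C \<Longrightarrow> compactin D {d \<in> topspace D. \<phi> d \<in> C}"
    and F: "\<And>d. d \<in> topspace D \<Longrightarrow> F (e d) = Some (\<phi> d)"
      "\<And>k. k \<in> topspace K - e ` topspace D \<Longrightarrow> F k = None"
  shows "continuous_map K (Alexandroff_compactification Y) F"
  unfolding continuous_map_def
proof (intro conjI allI impI)
  have eD: "e ` topspace D \<subseteq> topspace K"
    using e(2) by (simp add: continuous_map_image_subset_topspace)
  have Y: "\<phi> d \<in> topspace Y" if "d \<in> topspace D" for d
    using \<phi>(1) that by (simp add: continuous_map_def Pi_iff)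
  have pre: "{k \<in> topspace K. F k \<in> Some ` S} = e ` {d \<in> topspace D. \<phi> d \<in> S}" for S
  proof (intro set_eqI iffI)
    fix k assume "k \<in> {k \<in> topspace K. F k \<in> Some ` S}"
    then have k: "k \<in> topspace K" "F k \<in> Some ` S" by auto
    then have "k \<in> e ` topspace D"
      using F(2)[of k] by fastforce
    then obtain d where "d \<in> topspace D" "k = e d" by blast
    then show "k \<in> e ` {d \<in> topspace D. \<phi> d \<in> S}"
      using k(2) F(1)[of d] by auto
  next
    fix k assume "k \<in> e ` {d \<in> topspace D. \<phi> d \<in> S}"
    then obtain d where "d \<in> topspace D" "\<phi> d \<in> S" "k = e d" by blast
    then show "k \<in> {k \<in> topspace K. F k \<in> Some ` S}"
      using eD F(1)[of d] by auto
  qed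
  have top: "F k \<in> topspace (Alexandroff_compactification Y)" if k: "k \<in> topspace K" for k
  proof (cases "k \<in> e ` topspace D")
    case True
    then obtain d where "d \<in> topspace D" "k = e d" by blast
    then show ?thesis
      using F(1)[of d] Y[of d] by simp
  next
    case False
    then show ?thesis
      using F(2)[of k] k by simp
  qed
  then show "F \<in> topspace K \<rightarrow> topspace (Alexandroff_compactification Y)"
    by blast
  fix S assume "openin (Alexandroff_compactification Y) S"
  then consider U where "openin Y U" "S = Some ` U"
    | C where "compactin Y C" "closedin Y C" "S = insert None (Some ` (topspace Y - C))"
    by (auto simp: openin_Alexandroff_compactification)
  then show "openin K {k \<in> topspace K. F k \<in> S}"
  proof cases
    case 1
    then have "openin D {d \<in> topspace D. \<phi> d \<in> U}"
      using \<phi>(1) openin_continuous_map_preimage by blast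
    then show ?thesis
      unfolding 1 pre using e(1) by (simp add: open_map_def)
  next
    case 2
    have C: "closedin K {k \<in> topspace K. F k \<in> Some ` C}"
      unfolding pre
      by (rule compactin_imp_closedin[OF K image_compactin[OF \<phi>(2)[OF 2(1)] e(2)]])
    have "F k \<in> S \<longleftrightarrow> F k \<notin> Some ` C" if "k \<in> topspace K" for k
      using top[OF that] 2(3) by auto
    then have "{k \<in> topspace K. F k \<in> S} = topspace K - {k \<in> topspace K. F k \<in> Some ` C}"
      by blast
    then show ?thesis
      using C by (simp add: openin_diff)
  qed
qed

section \<open>Mapping cones of one-point compactifications\<close>

text \<open>The relations collapsed by \<open>smash\<close> and \<open>mapping_cone\<close>, named so that their classes can be
  mentioned.\<close>

definition smash_rel :: "'a c2space \<Rightarrow> 'b c2space \<Rightarrow> (('a \<times> 'b) \<times> ('a \<times> 'b)) set" where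
  "smash_rel A B =
     {(p, (cbase A, cbase B)) | p. p \<in> topspace (prod_topology (ctop A) (ctop B)) \<and>
        (fst p = cbase A \<or> snd p = cbase B)}"

lemma smash_simps:
  "ctop (smash A B) = quotient_top (prod_topology (ctop A) (ctop B)) (smash_rel A B)"
  "cbase (smash A B) = eq_class (smash_rel A B) (cbase A, cbase B)"
  "cact (smash A B) = (\<lambda>c. map_prod (cact A) (cact B) ` c)"
  by (simp_all add: smash_def smash_rel_def Let_def)

definition cone_rel ::
  "'a c2space \<Rightarrow> 'b c2space \<Rightarrow> ('a \<Rightarrow> 'b) \<Rightarrow> (('a \<times> ennreal + 'b) \<times> ('a \<times> ennreal + 'b)) set" where
  "cone_rel A B f =
     {(Inl (a, 0), Inr (f a)) | a. a \<in> topspace (ctop A)}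
     \<union> {(Inl (a, \<infinity>), Inr (cbase B)) | a. a \<in> topspace (ctop A)}
     \<union> {(Inl (cbase A, t), Inr (cbase B)) | t. True}"

lemma mapping_cone_simps:
  "ctop (mapping_cone A B f) =
     quotient_top (disj_sum_top (prod_topology (ctop A) euclidean) (ctop B)) (cone_rel A B f)"
  "cbase (mapping_cone A B f) = eq_class (cone_rel A B f) (Inr (cbase B))"
  "cact (mapping_cone A B f) = (\<lambda>c. map_sum (map_prod (cact A) (\<lambda>t. t)) (cact B) ` c)"
  by (simp_all add: mapping_cone_def cone_rel_def Let_def)

text \<open>The common form of Thom spaces and representation spheres.\<close>

definition Alexandroff_c2 :: "'a topology \<Rightarrow> ('a \<Rightarrow> 'a) \<Rightarrow> 'a option c2space" where
  "Alexandroff_c2 T \<alpha> =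
     \<lparr>ctop = Alexandroff_compactification T, cbase = None, cact = map_option \<alpha>\<rparr>"

lemma Alexandroff_c2_simps [simp]:
  "ctop (Alexandroff_c2 T \<alpha>) = Alexandroff_compactification T"
  "cbase (Alexandroff_c2 T \<alpha>) = None"
  "cact (Alexandroff_c2 T \<alpha>) = map_option \<alpha>"
  by (simp_all add: Alexandroff_c2_def)

text \<open>The extension of \<open>\<phi>\<close> from \<open>(P \<times> B) \<times> [0, \<infinity>)\<close> to \<open>(P\<^sup>+ \<times> B\<^sup>+) \<times> [0, \<infinity>]\<close> by the point at
  infinity. The cone parameter comes first because for each value of it the result factors through
  the smash product.\<close>

definition ray_extension :: "(('p \<times> 'b) \<times> real \<Rightarrow> 'z) \<Rightarrow> ennreal \<Rightarrow> 'p option \<times> 'b option \<Rightarrow> 'z option" where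
  "ray_extension \<phi> t pq = (case pq of
      (Some p, Some b) \<Rightarrow> if t = \<infinity> then None else Some (\<phi> ((p, b), enn2real t))
    | _ \<Rightarrow> None)"

lemma ray_extension_simps [simp]:
  "ray_extension \<phi> t (None, q) = None"
  "ray_extension \<phi> t (p, None) = None"
  "ray_extension \<phi> top pq = None"
  "0 \<le> s \<Longrightarrow> ray_extension \<phi> (ennreal s) (Some p', Some b') = Some (\<phi> ((p', b'), s))"
  "ray_extension \<phi> 0 (Some p', Some b') = Some (\<phi> ((p', b'), 0))"
  by (auto simp: ray_extension_def split: option.split prod.split)

lemma continuous_map_ray_extension:
  assumes P: "Hausdorff_space (Alexandroff_compactification P)"
    and B: "Hausdorff_space (Alexandroff_compactification B)"
    and \<phi>: "continuous_map (prod_topology (prod_topology P B) (top_of_set {0..})) Z \<phi>"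
    and proper: "\<And>C. compactin Z C \<Longrightarrow>
      compactin (prod_topology (prod_topology P B) (top_of_set {0..}))
        {d \<in> topspace (prod_topology (prod_topology P B) (top_of_set {0..})). \<phi> d \<in> C}"
  shows "continuous_map
    (prod_topology (prod_topology (Alexandroff_compactification P) (Alexandroff_compactification B)) euclidean)
    (Alexandroff_compactification Z) (\<lambda>(pq, t). ray_extension \<phi> t pq)"
proof (rule continuous_map_into_Alexandroff[OF _ _ _ \<phi> proper])
  let ?e = "map_prod (map_prod Some Some) ennreal"
  let ?D = "prod_topology (prod_topology P B) (top_of_set {0..})"
  let ?K = "prod_topology (prod_topology (Alexandroff_compactification P)
              (Alexandroff_compactification B)) (euclidean :: ennreal topology)"
  show "Hausdorff_space ?K"
    using P B Hausdorff_space_t2[where 'a = ennreal] by (simp add: Hausdorff_space_prod_topology)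
  show "open_map ?D ?K ?e"
    by (intro open_map_map_prod open_map_Some open_map_ennreal)
  have "continuous_on {0..} ennreal"
    by (intro continuous_on_ennreal continuous_on_id)
  then show "continuous_map ?D ?K ?e"
    by (intro continuous_map_map_prod continuous_map_Some) simp
  fix k assume "k \<in> topspace ?K - ?e ` topspace ?D"
  then have k: "k \<in> topspace ?K" "k \<notin> ?e ` topspace ?D" by auto
  obtain p q t where k_eq: "k = ((p, q), t)" by (metis surj_pair)
  show "(\<lambda>(pq, t). ray_extension \<phi> t pq) k = None"
  proof (rule ccontr)
    assume "(\<lambda>(pq, t). ray_extension \<phi> t pq) k \<noteq> None"
    then obtain p' b' where pb: "p = Some p'" "q = Some b'" and t: "t < top"
      by (auto simp: k_eq ray_extension_def less_top split: option.splits if_splits)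
    have "k = ?e ((p', b'), enn2real t)"
      using pb t by (simp add: k_eq)
    moreover have "((p', b'), enn2real t) \<in> topspace ?D"
      using k(1) pb by (auto simp: k_eq)
    ultimately show False
      using k(2) by blast
  qed
qed auto

text \<open>If a proper map \<open>\<phi>\<close> on \<open>P \<times> B \<times> [0, \<infinity>)\<close> is injective where the last coordinate is positive,
  and its restriction to the face \<open>P \<times> B \<times> {0}\<close> factors through a closed subspace \<open>\<psi>(Y)\<close> whose
  complement is the image of the positive part, then \<open>Z\<^sup>+\<close> is the mapping cone of
  \<open>P\<^sup>+ \<and> B\<^sup>+ \<rightarrow> Y\<^sup>+\<close>: the open cone coordinates fill \<open>Z - \<psi>(Y)\<close>, and everything the cone
  collapses is sent to infinity.

  The map \<open>F\<close> is defined on the disjoint union of cylinder and target. Its continuity on the cylinder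
  is tested on \<open>P\<^sup>+ \<times> B\<^sup>+ \<times> [0, \<infinity>]\<close>, because the product of a quotient map with the compact space
  \<open>[0, \<infinity>]\<close> is again a quotient map.\<close>

lemma mapping_cone_smash_Alexandroff:
  fixes P :: "'p topology" and B :: "'b topology" and Y :: "'y topology" and Z :: "'z topology"
    and \<phi> :: "('p \<times> 'b) \<times> real \<Rightarrow> 'z" and \<psi> :: "'y \<Rightarrow> 'z" and \<kappa> :: "'p \<times> 'b \<Rightarrow> 'y"
    and f :: "('p option \<times> 'b option) set \<Rightarrow> 'y option"
    and \<alpha> :: "'p \<Rightarrow> 'p" and \<beta> :: "'b \<Rightarrow> 'b" and \<eta> :: "'y \<Rightarrow> 'y" and \<rho> :: "'z \<Rightarrow> 'z"
  defines "D \<equiv> prod_topology (prod_topology P B) (top_of_set {0..})"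
    and "A \<equiv> smash (Alexandroff_c2 P \<alpha>) (Alexandroff_c2 B \<beta>)"
    and "r \<equiv> smash_rel (Alexandroff_c2 P \<alpha>) (Alexandroff_c2 B \<beta>)"
  assumes Hausdorff: "Hausdorff_space (Alexandroff_compactification P)"
      "Hausdorff_space (Alexandroff_compactification B)"
      "Hausdorff_space (Alexandroff_compactification Y)"
      "Hausdorff_space (Alexandroff_compactification Z)"
    and \<phi>: "continuous_map D Z \<phi>"
    and \<phi>_proper: "\<And>C. compactin Z C \<Longrightarrow> compactin D {d \<in> topspace D. \<phi> d \<in> C}"
    and \<psi>: "continuous_map Y Z \<psi>"
    and \<psi>_proper: "\<And>C. compactin Z C \<Longrightarrow> compactin Y {y \<in> topspace Y. \<psi> y \<in> C}"
    and \<kappa>: "\<And>p b. p \<in> topspace P \<Longrightarrow> b \<in> topspace B \<Longrightarrow>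
          \<kappa> (p, b) \<in> topspace Y \<and> \<psi> (\<kappa> (p, b)) = \<phi> ((p, b), 0)"
    and f_Some: "\<And>p b. p \<in> topspace P \<Longrightarrow> b \<in> topspace B \<Longrightarrow>
          f (eq_class r (Some p, Some b)) = Some (\<kappa> (p, b))"
    and f_None: "f (eq_class r (None, None)) = None"
    and \<psi>_inj: "inj_on \<psi> (topspace Y)"
    and \<phi>_inj: "inj_on \<phi> ((topspace P \<times> topspace B) \<times> {0<..})"
    and disjoint: "\<psi> ` topspace Y \<inter> \<phi> ` ((topspace P \<times> topspace B) \<times> {0<..}) = {}"
    and cover: "topspace Z \<subseteq> \<psi> ` topspace Y \<union> \<phi> ` ((topspace P \<times> topspace B) \<times> {0<..})"
    and \<phi>_act: "\<And>p b t. p \<in> topspace P \<Longrightarrow> b \<in> topspace B \<Longrightarrow> t \<ge> 0 \<Longrightarrow>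
          \<phi> ((\<alpha> p, \<beta> b), t) = \<rho> (\<phi> ((p, b), t))"
    and \<psi>_act: "\<And>y. y \<in> topspace Y \<Longrightarrow> \<psi> (\<eta> y) = \<rho> (\<psi> y)"
  shows "c2_homeomorphic (mapping_cone A (Alexandroff_c2 Y \<eta>) f) (Alexandroff_c2 Z \<rho>)"
proof -
  let ?PB = "prod_topology (Alexandroff_compactification P) (Alexandroff_compactification B)"
  let ?T = "disj_sum_top (prod_topology (ctop A) (euclidean :: ennreal topology))
              (Alexandroff_compactification Y)"
  let ?R = "cone_rel A (Alexandroff_c2 Y \<eta>) f"
  define F :: "('p option \<times> 'b option) set \<times> ennreal + 'y option \<Rightarrow> 'z option" where
    "F = (\<lambda>z. case z of Inl (c, t) \<Rightarrow> the_elem (ray_extension \<phi> t ` c) | Inr y \<Rightarrow> map_option \<psi> y)"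
  have F_Inr: "F (Inr y) = map_option \<psi> y" for y
    by (simp add: F_def)
  have ray_r: "ray_extension \<phi> t x = ray_extension \<phi> t y" if "(x, y) \<in> r" for x y t
    using that by (auto simp: r_def smash_rel_def)
  have F_Inl: "F (Inl (eq_class r pq, t)) = ray_extension \<phi> t pq" for pq t
  proof -
    have "the_elem (ray_extension \<phi> t ` eq_class r pq) = ray_extension \<phi> t pq"
      by (rule the_elem_image_eq_class) (rule ray_r)
    then show ?thesis by (simp add: F_def)
  qed
  have topA: "ctop A = quotient_top ?PB r" "cbase A = eq_class r (None, None)"
    "cact A = (\<lambda>c. map_prod (map_option \<alpha>) (map_option \<beta>) ` c)"
    by (simp_all add: A_def r_def smash_simps)
  have topspA: "topspace (ctop A) = eq_class r ` topspace ?PB"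
    by (simp only: topA topspace_quotient_top)
  have r_None: "eq_class r pq = cbase A"
    if "pq \<in> topspace ?PB" "fst pq = None \<or> snd pq = None" for pq
    unfolding topA using that by (intro eq_class_eqI) (auto simp: r_def smash_rel_def)
  have topA_cases: "a = cbase A \<or> (\<exists>p\<in>topspace P. \<exists>b\<in>topspace B. a = eq_class r (Some p, Some b))"
    if a: "a \<in> topspace (ctop A)" for a
  proof -
    obtain p b where pb: "a = eq_class r (p, b)" "(p, b) \<in> topspace ?PB"
      using a unfolding topspA by auto
    show ?thesis
    proof (cases "p = None \<or> b = None")
      case True
      then show ?thesis using r_None[OF pb(2)] pb(1) by simp
    next
      case False
      then show ?thesis using pb by auto
    qed
  qed
  have base_in: "cbase A \<in> topspace (ctop A)"
    unfolding topspA topA(2) by (rule imageI) simp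
  have Some_in: "eq_class r (Some p, Some b) \<in> topspace (ctop A)"
    if "p \<in> topspace P" "b \<in> topspace B" for p b
    unfolding topspA using that by (intro imageI) simp
  have F_base: "F (Inl (cbase A, t)) = None" for t
    unfolding topA(2) F_Inl by simp
  have F_Some: "F (Inl (eq_class r (Some p, Some b), ennreal t)) = Some (\<phi> ((p, b), t))" if "0 \<le> t" for p b t
    unfolding F_Inl using that by simp
  have f_base: "f (cbase A) = None"
    unfolding topA(2) by (rule f_None)
  have f_in: "f a \<in> topspace (Alexandroff_compactification Y)" if "a \<in> topspace (ctop A)" for a
    using topA_cases[OF that] f_base f_Some \<kappa> by auto
  have F_0: "F (Inl (a, 0)) = F (Inr (f a))" if "a \<in> topspace (ctop A)" for a
    using topA_cases[OF that]
  proof (elim disjE bexE)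
    assume "a = cbase A"
    then show ?thesis by (simp add: F_base F_Inr f_base)
  next
    fix p b assume "p \<in> topspace P" "b \<in> topspace B" "a = eq_class r (Some p, Some b)"
    then show ?thesis
      using F_Some[of 0 p b] f_Some[of p b] \<kappa>[of p b] by (simp add: F_Inr)
  qed
  have F_inf: "F (Inl (a, \<infinity>)) = None" if "a \<in> topspace (ctop A)" for a
    using topA_cases[OF that] by (auto simp: F_base F_Inl)
  have F_R: "F x = F y" if "(x, y) \<in> ?R" for x y
    using that unfolding cone_rel_def by (auto simp: F_0 F_inf[simplified] F_base F_Inr)
  have topT: "topspace ?T = Inl ` (topspace (ctop A) \<times> UNIV) \<union> Inr ` topspace (Alexandroff_compactification Y)"
    by (simp add: topspace_disj_sum_top)
  have R_sub: "?R \<subseteq> topspace ?T \<times> topspace ?T"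
  proof -
    have "Inl (a, t) \<in> topspace ?T" "Inr (f a) \<in> topspace ?T" if "a \<in> topspace (ctop A)" for a t
      unfolding topT using that f_in[OF that] by blast+
    moreover have "Inr None \<in> topspace ?T"
      unfolding topT by simp
    ultimately show ?thesis
      unfolding cone_rel_def Alexandroff_c2_simps using base_in by blast
  qed
  \<comment> \<open>The points that remain after the collapse: every class of the cone contains exactly one of them,
    and \<open>F\<close> is injective on them.\<close>
  define N where "N = Inr ` topspace (Alexandroff_compactification Y) \<union>
    {Inl (eq_class r (Some p, Some b), ennreal t) | p b t. p \<in> topspace P \<and> b \<in> topspace B \<and> 0 < t}"
  have N_sub: "N \<subseteq> topspace ?T"
    unfolding N_def topT using Some_in by auto
  have normal: "\<exists>z'\<in>N. eq_class ?R z = eq_class ?R z' \<and> F z = F z'" if z: "z \<in> topspace ?T" for z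
  proof -
    have Inr_case: ?thesis if "(z, Inr y) \<in> ?R" "Inr y \<in> N" for y
      using that eq_class_eqI[OF that(1)] F_R[OF that(1)] by auto
    have NNone: "Inr None \<in> N" by (simp add: N_def)
    show ?thesis
    proof (cases z)
      case (Inr y)
      then have "z \<in> N"
        using z unfolding topT N_def by auto
      then show ?thesis by auto
    next
      case (Inl w)
      obtain a t where z_eq: "z = Inl (a, t)"
        using Inl by (cases w) auto
      then have a: "a \<in> topspace (ctop A)"
        using z unfolding topT by auto
      consider "a = cbase A" | "t = \<infinity>" | "t = 0"
        | p b where "p \<in> topspace P" "b \<in> topspace B" "a = eq_class r (Some p, Some b)" "0 < t" "t < \<infinity>"
        using topA_cases[OF a] by (metis infinity_ennreal_def less_top not_gr_zero)
      then show ?thesis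
      proof cases
        case 1
        then have "(z, Inr None) \<in> ?R" by (simp add: z_eq cone_rel_def)
        then show ?thesis using NNone by (rule Inr_case)
      next
        case 2
        then have "(z, Inr None) \<in> ?R" using a by (simp add: z_eq cone_rel_def)
        then show ?thesis using NNone by (rule Inr_case)
      next
        case 3
        then have "(z, Inr (f a)) \<in> ?R" using a by (simp add: z_eq cone_rel_def)
        moreover have "Inr (f a) \<in> N" unfolding N_def using f_in[OF a] by blast
        ultimately show ?thesis by (rule Inr_case)
      next
        case 4
        then have "z = Inl (eq_class r (Some p, Some b), ennreal (enn2real t))" "0 < enn2real t"
          using z_eq by (simp_all add: enn2real_positive_iff)
        then have "z \<in> N"
          using 4(1,2) unfolding N_def by blast
        then show ?thesis by auto
      qed
    qed
  qed
  have F_N: "inj_on F N"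
  proof (rule inj_onI)
    have pos: "z \<in> \<phi> ` ((topspace P \<times> topspace B) \<times> {0<..})"
      if "F (Inl (eq_class r (Some p, Some b), ennreal t)) = Some z" 
         "p \<in> topspace P" "b \<in> topspace B" "0 < t" for p b t z
      using that F_Some[of t p b] by force
    have mixed: False if H: "F (Inl (eq_class r (Some p, Some b), ennreal t)) = F (Inr y)"
        "p \<in> topspace P" "b \<in> topspace B" "0 < t" "y \<in> topspace (Alexandroff_compactification Y)" for p b t y
    proof -
      have "map_option \<psi> y = Some (\<phi> ((p, b), t))"
        using H(1,4) F_Some[of t p b] by (simp add: F_Inr)
      then obtain y' where "y' \<in> topspace Y" "\<psi> y' = \<phi> ((p, b), t)"
        using H(5) by auto
      moreover have "((p, b), t) \<in> (topspace P \<times> topspace B) \<times> {0<..}"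
        using H by simp
      ultimately show False
        using disjoint by (metis disjoint_iff imageI)
    qed
    fix x y assume xy: "x \<in> N" "y \<in> N" "F x = F y"
    from xy(1,2) consider u v where "x = Inr u" "y = Inr v"
        "u \<in> topspace (Alexandroff_compactification Y)" "v \<in> topspace (Alexandroff_compactification Y)"
      | u p b t where "{x, y} = {Inr u, Inl (eq_class r (Some p, Some b), ennreal t)}"
        "u \<in> topspace (Alexandroff_compactification Y)" "p \<in> topspace P" "b \<in> topspace B" "0 < t"
      | p b t p' b' t' where "x = Inl (eq_class r (Some p, Some b), ennreal t)"
          "p \<in> topspace P" "b \<in> topspace B" "0 < t"
          "y = Inl (eq_class r (Some p', Some b'), ennreal t')"
          "p' \<in> topspace P" "b' \<in> topspace B" "0 < t'"
      unfolding N_def by blast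
    then show "x = y"
    proof cases
      case 1
      then have "map_option \<psi> u = map_option \<psi> v"
        using xy(3) by (simp add: F_Inr)
      then have "u = v"
        using 1(3,4) inj_onD[OF \<psi>_inj] by auto
      then show ?thesis using 1 by simp
    next
      case 2
      then have "F (Inl (eq_class r (Some p, Some b), ennreal t)) = F (Inr u)"
        using xy(3) by (auto simp: doubleton_eq_iff)
      then show ?thesis using mixed 2 by blast
    next
      case 3
      then have "\<phi> ((p, b), t) = \<phi> ((p', b'), t')"
        using xy(3) F_Some[of t p b] F_Some[of t' p' b'] by simp
      then have "((p, b), t) = ((p', b'), t')"
        using 3 by (intro inj_onD[OF \<phi>_inj]) auto
      then show ?thesis using 3 by simp
    qed
  qed
  have hom: "homeomorphic_map (quotient_top ?T ?R) (Alexandroff_compactification Z) (\<lambda>c. the_elem (F ` c))"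
  proof (rule homeomorphic_map_quotient_top)
    have cA: "compact_space (ctop A)"
      unfolding topA by (intro compact_space_quotient_top) (simp add: compact_space_prod_topology)
    show "compact_space ?T"
      by (intro compact_space_disj_sum_top) (simp_all add: compact_space_prod_topology cA compact_space_ennreal)
    show "continuous_map ?T (Alexandroff_compactification Z) F"
    proof (rule continuous_map_disj_sum_top)
      have q: "quotient_map (prod_topology ?PB (euclidean :: ennreal topology)) (prod_topology (ctop A) euclidean)
              (\<lambda>(x, y). (eq_class r x, y))"
        unfolding topA
        by (intro quotient_map_prod_left quotient_map_eq_class)
          (simp_all add: compact_imp_locally_compact_space compact_space_ennreal Hausdorff_space_t2)
      have F_q: "F \<circ> Inl \<circ> (\<lambda>(x, y). (eq_class r x, y)) = (\<lambda>(pq, t). ray_extension \<phi> t pq)"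
        by (auto simp: F_Inl)
      have "continuous_map (prod_topology ?PB euclidean) (Alexandroff_compactification Z)
          (\<lambda>(pq, t). ray_extension \<phi> t pq)"
        by (rule continuous_map_ray_extension[OF Hausdorff(1,2) \<phi>[unfolded D_def]])
          (rule \<phi>_proper[unfolded D_def])
      then show "continuous_map (prod_topology (ctop A) euclidean) (Alexandroff_compactification Z) (F \<circ> Inl)"
        unfolding F_q[symmetric] by (rule continuous_compose_quotient_map[OF q])
      show "continuous_map (Alexandroff_compactification Y) (Alexandroff_compactification Z) (F \<circ> Inr)"
        by (rule continuous_map_into_Alexandroff[OF Hausdorff(3) open_map_Some continuous_map_Some \<psi> \<psi>_proper])
          (auto simp: F_Inr)
    qed
    show "F ` topspace ?T = topspace (Alexandroff_compactification Z)"
    proof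
      show "topspace (Alexandroff_compactification Z) \<subseteq> F ` topspace ?T"
      proof
        fix z assume "z \<in> topspace (Alexandroff_compactification Z)"
        then consider "z = None" | y where "y \<in> topspace Y" "z = Some (\<psi> y)"
          | p b t where "p \<in> topspace P" "b \<in> topspace B" "0 < t" "z = Some (\<phi> ((p, b), t))"
          using cover by auto
        then have "z \<in> F ` N"
        proof cases
          case 1
          then have "z = F (Inr None)" by (simp add: F_Inr)
          then show ?thesis by (simp add: N_def)
        next
          case 2
          then have "z = F (Inr (Some y))" by (simp add: F_Inr)
          then show ?thesis using 2 by (simp add: N_def)
        next
          case 3
          then have "z = F (Inl (eq_class r (Some p, Some b), ennreal t))"
            using F_Some[of t p b] by simp
          then show ?thesis using 3 unfolding N_def by blast
        qed
        then show "z \<in> F ` topspace ?T"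
          using N_sub by blast
      qed
      show "F ` topspace ?T \<subseteq> topspace (Alexandroff_compactification Z)"
      proof (rule image_subsetI)
        fix z assume "z \<in> topspace ?T"
        then obtain z' where z': "z' \<in> N" "F z = F z'"
          using normal by blast
        have \<phi>Z: "\<phi> ((p, b), t) \<in> topspace Z" if "p \<in> topspace P" "b \<in> topspace B" "0 < t" for p b t
          using \<phi> that unfolding D_def continuous_map_def Pi_iff by simp
        have \<psi>Z: "\<psi> y \<in> topspace Z" if "y \<in> topspace Y" for y
          using \<psi> that unfolding continuous_map_def Pi_iff by simp
        from z'(1) show "F z \<in> topspace (Alexandroff_compactification Z)"
          unfolding z'(2) N_def using \<phi>Z \<psi>Z by (auto simp: F_Inr F_Some less_imp_le)
      qed
    qed
    show "eq_class ?R x = eq_class ?R y" if xy: "x \<in> topspace ?T" "y \<in> topspace ?T" "F x = F y" for x y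
    proof -
      obtain x' y' where "x' \<in> N" "eq_class ?R x = eq_class ?R x'" "F x = F x'"
        "y' \<in> N" "eq_class ?R y = eq_class ?R y'" "F y = F y'"
        using normal xy(1,2) by meson
      with xy(3) inj_onD[OF F_N, of x' y'] show ?thesis by simp
    qed
  qed (use Hausdorff F_R in blast)+
  have act: "F (map_sum (map_prod (cact A) (\<lambda>t. t)) (map_option \<eta>) z) = map_option \<rho> (F z)"
    if z: "z \<in> topspace ?T" for z
  proof (cases z)
    case (Inr y)
    then show ?thesis
      using z \<psi>_act unfolding topT by (cases y) (auto simp: F_Inr)
  next
    case (Inl w)
    then obtain pq t where pq: "z = Inl (eq_class r pq, t)" "pq \<in> topspace ?PB"
      using z unfolding topT topspA by auto
    have "F (Inl (map_prod (map_option \<alpha>) (map_option \<beta>) ` eq_class r pq, t)) =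
      the_elem (ray_extension \<phi> t ` map_prod (map_option \<alpha>) (map_option \<beta>) ` eq_class r pq)"
      by (simp add: F_def)
    also have "\<dots> = map_option \<rho> (ray_extension \<phi> t pq)"
    proof (rule the_elem_equivariant[OF _ pq(2)])
      show "r \<subseteq> topspace ?PB \<times> topspace ?PB"
        by (auto simp: r_def smash_rel_def)
      show "ray_extension \<phi> t x = ray_extension \<phi> t y" if "(x, y) \<in> r" for x y
        using that by (rule ray_r)
      show "ray_extension \<phi> t (map_prod (map_option \<alpha>) (map_option \<beta>) y) = map_option \<rho> (ray_extension \<phi> t y)"
        if "y \<in> topspace ?PB" for y
        using that \<phi>_act by (auto simp: ray_extension_def split: option.splits)
    qed
    finally show ?thesis
      by (simp add: pq(1) topA F_Inl)
  qed
  show ?thesis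
    unfolding c2_homeomorphic_def mapping_cone_simps Alexandroff_c2_simps
  proof (intro exI conjI ballI)
    show "homeomorphic_map (quotient_top ?T ?R) (Alexandroff_compactification Z) (\<lambda>c. the_elem (F ` c))"
      by (rule hom)
    have "the_elem (F ` eq_class ?R (Inr None)) = F (Inr None)"
      by (rule the_elem_image_eq_class) (rule F_R)
    then show "the_elem (F ` eq_class ?R (Inr None)) = None"
      by (simp add: F_Inr)
    fix c assume "c \<in> topspace (quotient_top ?T ?R)"
    then obtain z where z: "z \<in> topspace ?T" "c = eq_class ?R z"
      unfolding topspace_quotient_top by blast
    have "the_elem (F ` map_sum (map_prod (cact A) (\<lambda>t. t)) (map_option \<eta>) ` eq_class ?R z) = map_option \<rho> (F z)"
      by (rule the_elem_equivariant[OF R_sub z(1)]) (fact F_R, fact act)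
    moreover have "the_elem (F ` eq_class ?R z) = F z"
      by (rule the_elem_image_eq_class) (rule F_R)
    ultimately show "the_elem (F ` map_sum (map_prod (cact A) (\<lambda>t. t)) (map_option \<eta>) ` c) = map_option \<rho> (the_elem (F ` c))"
      by (simp only: z(2))
  qed
qed

section \<open>Tensor products and Thom spaces in coordinates\<close>

lemma orthogonal_decomposition:
  fixes S :: "'a::euclidean_space set"
  assumes "subspace S"
  obtains a b where "a \<in> S" "b \<in> orthogonal_comp S" "u = a + b"
  using subspace_sum_orthogonal_comp[OF assms] by (metis UNIV_I set_plus_elim)

lemma mem_orthogonal_comp: "x \<in> orthogonal_comp S \<longleftrightarrow> (\<forall>y\<in>S. y \<bullet> x = 0)"
  by (simp add: orthogonal_comp_def orthogonal_def)

text \<open>With \<open>w \<otimes> v\<close> read as \<open>z \<mapsto> \<langle>w, z\<rangle> v\<close>, the tensor product of two subspaces consists of the linear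
  maps that vanish on \<open>S\<bottom>\<close> and take values in \<open>T\<close>; conversely such a map is
  \<open>\<Sum>b. b \<otimes> t b\<close> over an orthonormal basis of \<open>S\<close>. This turns all membership questions about
  \<open>W \<otimes> f(U)\<bottom>\<close> into pointwise conditions.\<close>

lemma mem_tens_space:
  fixes t :: "'w::euclidean_space \<Rightarrow>\<^sub>L 'v::euclidean_space"
  assumes S: "subspace S" and T: "subspace T"
  shows "t \<in> tens_space S T \<longleftrightarrow> (\<forall>z\<in>orthogonal_comp S. t z = 0) \<and> (\<forall>z. t z \<in> T)"
proof
  have "tens_space S T \<subseteq> {t :: 'w \<Rightarrow>\<^sub>L 'v. (\<forall>z\<in>orthogonal_comp S. t z = 0) \<and> (\<forall>z. t z \<in> T)}"
    unfolding tens_space_def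
  proof (rule span_minimal)
    show "{tens w v |w v. w \<in> S \<and> v \<in> T} \<subseteq> {t :: 'w \<Rightarrow>\<^sub>L 'v. (\<forall>z\<in>orthogonal_comp S. t z = 0) \<and> (\<forall>z. t z \<in> T)}"
      using T by (auto simp: tens_apply mem_orthogonal_comp subspace_scale)
    show "subspace {t::'w \<Rightarrow>\<^sub>L 'v. (\<forall>z\<in>orthogonal_comp S. t z = 0) \<and> (\<forall>z. t z \<in> T)}"
      using T by (auto simp: subspace_def blinfun.bilinear_simps)
  qed
  then show "t \<in> tens_space S T \<Longrightarrow> (\<forall>z\<in>orthogonal_comp S. t z = 0) \<and> (\<forall>z. t z \<in> T)"
    by blast
next
  assume t: "(\<forall>z\<in>orthogonal_comp S. t z = 0) \<and> (\<forall>z. t z \<in> T)"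
  obtain B where B: "B \<subseteq> S" "pairwise orthogonal B" "\<And>x. x \<in> B \<Longrightarrow> norm x = 1"
      "independent B" "span B = S"
    using orthonormal_basis_subspace[OF S] by metis
  have fin: "finite B" using B(4) by (rule independent_imp_finite)
  have "t = (\<Sum>b\<in>B. tens b (t b))"
  proof (rule blinfun_eqI)
    fix z
    obtain a c where z: "a \<in> S" "c \<in> orthogonal_comp S" "z = a + c"
      using S by (rule orthogonal_decomposition)
    have "t z = t a"
      using t z by (simp add: blinfun.add_right)
    also have "\<dots> = t (\<Sum>b\<in>B. (a \<bullet> b) *\<^sub>R b)"
      using orthonormal_basis_expand[OF B(2,3) _ fin, of a] z(1) B(5) by simp
    also have "\<dots> = (\<Sum>b\<in>B. (b \<bullet> z) *\<^sub>R t b)"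
    proof -
      have "b \<bullet> z = a \<bullet> b" if "b \<in> B" for b
        using z(2) that B(1) by (auto simp: z(3) inner_add_right mem_orthogonal_comp inner_commute)
      then show ?thesis
        by (simp add: blinfun.sum_right blinfun.scaleR_right)
    qed
    finally show "t z = blinfun_apply (\<Sum>b\<in>B. tens b (t b)) z"
      by (simp add: blinfun.sum_left tens_apply)
  qed
  moreover have "(\<Sum>b\<in>B. tens b (t b)) \<in> tens_space S T"
    unfolding tens_space_def using t B(1) by (intro span_sum span_base) blast
  ultimately show "t \<in> tens_space S T" by simp
qed

lemma mem_gamma_bundle:
  assumes "subspace (carr W)" and "subspace (carr V)"
  shows "(f, x) \<in> gamma_bundle W U V \<longleftrightarrow>
    f \<in> lin_iso U V \<and> (\<forall>z\<in>orthogonal_comp (carr W). x z = 0) \<and> (\<forall>z. x z \<in> carr V) \<and>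
    (\<forall>z. \<forall>u\<in>carr U. blinfun_apply f u \<bullet> x z = 0)"
  using assms
  by (simp add: gamma_bundle_def mem_tens_space subspace_inter subspace_orthogonal_comp
      mem_orthogonal_comp) blast

lemma closed_lin_iso:
  fixes U :: "'u::euclidean_space c2rep" and V :: "'v::euclidean_space c2rep"
  assumes "subspace (carr V)"
  shows "closed (lin_iso U V)"
proof -
  have "lin_iso U V = (\<Inter>u\<in>carr U. {f. blinfun_apply f u \<in> carr V} \<inter> {f. norm (blinfun_apply f u) = norm u}) \<inter>
      (\<Inter>u\<in>orthogonal_comp (carr U). {f. blinfun_apply f u = 0})"
    by (auto simp: lin_iso_def)
  moreover have "closed {f :: 'u \<Rightarrow>\<^sub>L 'v. f u \<in> carr V}" for u
    by (rule continuous_closed_vimage[OF closed_subspace[OF assms], of "\<lambda>f. blinfun_apply f u", unfolded vimage_def])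
      (intro continuous_intros)
  ultimately show ?thesis
    by (auto intro!: closed_Int closed_INT closed_Collect_eq continuous_intros)
qed

lemma closed_gamma_bundle:
  fixes U :: "'u::euclidean_space c2rep" and V :: "'v::euclidean_space c2rep" 
    and W :: "'w::euclidean_space c2rep"
  assumes "subspace (carr W)" and "subspace (carr V)"
  shows "closed (gamma_bundle W U V)"
proof -
  have "gamma_bundle W U V = fst -` lin_iso U V \<inter>
     (\<Inter>z\<in>orthogonal_comp (carr W). {p. blinfun_apply (snd p) z = 0}) \<inter> (\<Inter>z. {p. blinfun_apply (snd p) z \<in> carr V}) \<inter>
     (\<Inter>z. \<Inter>u\<in>carr U. {p. blinfun_apply (fst p) u \<bullet> blinfun_apply (snd p) z = 0})"
    using mem_gamma_bundle[OF assms] by (intro set_eqI) (simp add: split_paired_all)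
  moreover have "closed {p :: ('u \<Rightarrow>\<^sub>L 'v) \<times> ('w \<Rightarrow>\<^sub>L 'v). blinfun_apply (snd p) z \<in> carr V}" for z
    by (rule continuous_closed_vimage[OF closed_subspace[OF assms(2)],
          of "\<lambda>p. blinfun_apply (snd p) z", unfolded vimage_def])
      (intro continuous_intros)
  moreover have "closed (fst -` lin_iso U V :: (('u \<Rightarrow>\<^sub>L 'v) \<times> ('w \<Rightarrow>\<^sub>L 'v)) set)"
    using closed_lin_iso[OF assms(2)] by (rule closed_vimage_fst)
  ultimately show ?thesis
    by (auto intro!: closed_Int closed_INT closed_Collect_eq continuous_intros)
qed

lemma Hausdorff_Alexandroff_closed:
  fixes S :: "'a::heine_borel set"
  assumes "closed S"
  shows "Hausdorff_space (Alexandroff_compactification (top_of_set S))"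
proof -
  have "Hausdorff_space (top_of_set S)"
    using Hausdorff_space_t2 by (rule Hausdorff_space_subtopology)
  moreover have "locally_compact_space (top_of_set S)"
    using assms by (intro locally_compact_space_closed_subset locally_compact_space_euclidean) simp
  ultimately show ?thesis
    by (simp add: Hausdorff_space_Alexandroff_compactification)
qed

text \<open>Properness of a map that does not shrink norms by more than a linear factor.\<close>

lemma compactin_preimage_of_norm_bound:
  fixes \<phi> :: "'a::{heine_borel, real_normed_vector} \<Rightarrow> 'b::real_normed_vector"
  assumes D: "closed D" and \<phi>: "continuous_on D \<phi>"
    and bound: "\<And>d. d \<in> D \<Longrightarrow> norm d \<le> a + b * norm (\<phi> d)" and b: "0 \<le> b"
    and C: "compactin (top_of_set E) C"
  shows "compactin (top_of_set D) {d \<in> topspace (top_of_set D). \<phi> d \<in> C}"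
proof -
  have C: "compact C"
    using C by (simp add: compactin_subtopology)
  then obtain M where M: "\<And>c. c \<in> C \<Longrightarrow> norm c \<le> M"
    using compact_imp_bounded bounded_iff by metis
  have "norm d \<le> a + b * M" if "d \<in> D" "\<phi> d \<in> C" for d
    using bound[OF that(1)] mult_left_mono[OF M[OF that(2)] b] by linarith
  then have "bounded {d \<in> D. \<phi> d \<in> C}"
    unfolding bounded_iff by blast
  moreover have "closed (D \<inter> \<phi> -` C)"
    using continuous_closed_preimage[OF \<phi> D] C compact_imp_closed by blast
  moreover have "D \<inter> \<phi> -` C = {d \<in> D. \<phi> d \<in> C}" by blast
  ultimately have "compact {d \<in> D. \<phi> d \<in> C}"
    by (simp add: compact_eq_bounded_closed)
  then show ?thesis
    by (auto simp: compactin_subtopology)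
qed

lemma lin_iso_inner:
  assumes U: "subspace (carr U)" and f: "f \<in> lin_iso U V" and ab: "a \<in> carr U" "b \<in> carr U"
  shows "blinfun_apply f a \<bullet> blinfun_apply f b = a \<bullet> b"
proof -
  have "norm (blinfun_apply f (a + b)) = norm (a + b)"
    "norm (blinfun_apply f a) = norm a" "norm (blinfun_apply f b) = norm b"
    using f ab subspace_add[OF U ab] by (auto simp: lin_iso_def)
  then show ?thesis
    unfolding dot_norm[of a b] dot_norm[of "blinfun_apply f a"] blinfun.add_right[symmetric] by simp
qed

lemma norm_lin_iso_le:
  assumes U: "subspace (carr U)" and f: "f \<in> lin_iso U V"
  shows "norm f \<le> 1"
proof (rule norm_blinfun_bound)
  fix u
  obtain a c where u: "a \<in> carr U" "c \<in> orthogonal_comp (carr U)" "u = a + c"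
    using U by (rule orthogonal_decomposition)
  have "blinfun_apply f c = 0" "norm (blinfun_apply f a) = norm a"
    using f u(1,2) unfolding lin_iso_def by blast+
  then have 1: "norm (blinfun_apply f u) = norm a"
    unfolding u(3) blinfun.add_right by simp
  have "orthogonal a c"
    using u(1,2) by (simp add: orthogonal_comp_def)
  then have "(norm u)\<^sup>2 = (norm a)\<^sup>2 + (norm c)\<^sup>2"
    unfolding u(3) by (rule norm_add_Pythagorean)
  then have "(norm a)\<^sup>2 \<le> (norm u)\<^sup>2"
    by simp
  then have "norm a \<le> norm u"
    by (rule power2_le_imp_le) simp
  then show "norm (blinfun_apply f u) \<le> 1 * norm u"
    using 1 by simp
qed simp

lemma carr_rep_sum [simp]: "carr (rep_sum U X) = carr U \<times> carr X"
  and act_rep_sum [simp]: "act (rep_sum U X) = map_prod (act U) (act X)"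
  by (simp_all add: rep_sum_def)

lemma orthogonal_comp_Times_UNIV:
  assumes "0 \<in> S"
  shows "orthogonal_comp (S \<times> (UNIV :: 'b::euclidean_space set)) = orthogonal_comp S \<times> {0}"
proof -
  have "y \<in> orthogonal_comp S \<and> s = 0" if "(y, s) \<in> orthogonal_comp (S \<times> (UNIV :: 'b set))" for y s
  proof -
    have "\<forall>u\<in>S. \<forall>r. u \<bullet> y + r \<bullet> s = 0"
      using that by (simp add: mem_orthogonal_comp)
    then have "u \<bullet> y + 0 \<bullet> s = 0" "0 \<bullet> y + s \<bullet> s = 0" if "u \<in> S" for u
      using that assms by blast+
    then show ?thesis
      using assms by (simp add: mem_orthogonal_comp)
  qed
  then show ?thesis
    by (auto simp: mem_orthogonal_comp)
qed

definition blinfun_inl :: "'a::real_normed_vector \<Rightarrow>\<^sub>L ('a \<times> 'b::real_normed_vector)" where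
  "blinfun_inl = Blinfun (\<lambda>a. (a, 0))"

definition blinfun_inr :: "'b::real_normed_vector \<Rightarrow>\<^sub>L ('a::real_normed_vector \<times> 'b)" where
  "blinfun_inr = Blinfun (\<lambda>b. (0, b))"

lemma blinfun_inl_apply [simp]: "blinfun_apply blinfun_inl a = (a, 0)"
  unfolding blinfun_inl_def
  by (subst bounded_linear_Blinfun_apply) (auto intro!: bounded_linear_intros bounded_linear_Pair)

lemma blinfun_inr_apply [simp]: "blinfun_apply blinfun_inr b = (0, b)"
  unfolding blinfun_inr_def
  by (subst bounded_linear_Blinfun_apply) (auto intro!: bounded_linear_intros bounded_linear_Pair)

lemma blinfun_scaleR_snd: "blinfun_apply g (0, s) = s *\<^sub>R blinfun_apply g (0, 1)" for s :: real
  using blinfun.scaleR_right[of g s "(0, 1)"] by simp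

lemma blinfun_Pair_split: "blinfun_apply g (u, s) = blinfun_apply g (u, 0) + s *\<^sub>R blinfun_apply g (0, 1)" for s :: real
  using blinfun.add_right[of g "(u, 0)" "(0, s)"] by (simp add: blinfun_scaleR_snd[of g s])

text \<open>An isometry on \<open>U \<oplus> X\<close> with \<open>X\<close> a line is an isometry on \<open>U\<close> together with a unit vector,
  the image of \<open>1 \<in> X\<close>, orthogonal to its image.\<close>

lemma lin_iso_rep_sum_iff:
  fixes U :: "'u::euclidean_space c2rep" and V :: "'v::euclidean_space c2rep" and X :: "real c2rep"
  assumes U: "subspace (carr U)" and V: "subspace (carr V)" and X: "carr X = UNIV"
  shows "g \<in> lin_iso (rep_sum U X) V \<longleftrightarrow> 
    g o\<^sub>L blinfun_inl \<in> lin_iso U V \<and> g (0, 1) \<in> carr V \<and> norm (blinfun_apply g (0, 1)) = 1 \<and>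
    (\<forall>u\<in>carr U. blinfun_apply g (u, 0) \<bullet> blinfun_apply g (0, 1) = 0)" (is "?L \<longleftrightarrow> ?R")
proof -
  have 0: "0 \<in> carr U" using U by (rule subspace_0)
  have L: "g \<in> lin_iso (rep_sum U X) V \<longleftrightarrow>
      (\<forall>u\<in>carr U. \<forall>s. g (u, s) \<in> carr V \<and> norm (blinfun_apply g (u, s)) = norm (u, s)) \<and>
      (\<forall>u\<in>orthogonal_comp (carr U). blinfun_apply g (u, 0) = 0)"
    by (simp add: lin_iso_def X orthogonal_comp_Times_UNIV[OF 0])
  have F: "g o\<^sub>L blinfun_inl \<in> lin_iso U V \<longleftrightarrow>
      (\<forall>u\<in>carr U. g (u, 0) \<in> carr V \<and> norm (blinfun_apply g (u, 0)) = norm u) \<and>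
      (\<forall>u\<in>orthogonal_comp (carr U). blinfun_apply g (u, 0) = 0)"
    by (simp add: lin_iso_def)
  show ?thesis
  proof
    assume g: ?L
    have UX: "subspace (carr (rep_sum U X))"
      using U X by (simp add: subspace_Times)
    have "g (0, 1) \<in> carr V" and "norm (blinfun_apply g (0, 1)) = norm (0 :: 'u, 1 :: real)"
      using g 0 unfolding L by blast+
    moreover have "blinfun_apply g (u, 0) \<bullet> blinfun_apply g (0, 1) = 0" if "u \<in> carr U" for u
      using lin_iso_inner[OF UX g, of "(u, 0)" "(0, 1)"] that 0 X by simp
    moreover have "g (u, 0) \<in> carr V \<and> norm (blinfun_apply g (u, 0)) = norm u" if "u \<in> carr U" for u
      using g that unfolding L by (metis norm_Pair norm_zero real_sqrt_abs abs_norm_cancel add.right_neutral power_zero_numeral)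
    ultimately show ?R
      using g unfolding L F by (simp add: norm_Pair)
  next
    assume R: ?R
    have "g (u, s) \<in> carr V \<and> norm (blinfun_apply g (u, s)) = norm (u, s)" if u: "u \<in> carr U" for u s
    proof
      show "g (u, s) \<in> carr V"
        unfolding blinfun_Pair_split[of g u s]
        using R u unfolding F by (intro subspace_add[OF V] subspace_scale[OF V]) blast+
      have "orthogonal (blinfun_apply g (u, 0)) (s *\<^sub>R blinfun_apply g (0, 1))"
        using R u by (simp add: orthogonal_def)
      then have "(norm (g (u, s)))\<^sup>2 = (norm (g (u, 0)))\<^sup>2 + (norm (s *\<^sub>R g (0, 1)))\<^sup>2"
        unfolding blinfun_Pair_split[of g u s] by (rule norm_add_Pythagorean)
      also have "\<dots> = (norm u)\<^sup>2 + (norm s)\<^sup>2"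
        using R u unfolding F by simp
      also have "\<dots> = (norm (u, s))\<^sup>2"
        by (simp add: norm_Pair)
      finally show "norm (g (u, s)) = norm (u, s)" by simp
    qed
    then show ?L
      using R unfolding L F by blast
  qed
qed

text \<open>The bundle over \<open>L(U \<oplus> X, V)\<close> for \<open>W\<close>: the data are \<open>f = g|U\<close>, the unit vector
  \<open>v = g(0, 1)\<close>, and \<open>x\<close> with values orthogonal to both \<open>f(U)\<close> and \<open>v\<close>.\<close>

lemma mem_gamma_bundle_base_sum:
  fixes U :: "'u::euclidean_space c2rep" and V :: "'v::euclidean_space c2rep"
    and W :: "'w::euclidean_space c2rep" and X :: "real c2rep"
  assumes U: "subspace (carr U)" and V: "subspace (carr V)" and W: "subspace (carr W)"
    and X: "carr X = UNIV"
  shows "(g, x) \<in> gamma_bundle W (rep_sum U X) V \<longleftrightarrow>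
    g o\<^sub>L blinfun_inl \<in> lin_iso U V \<and> g (0, 1) \<in> carr V \<and> norm (blinfun_apply g (0, 1)) = 1 \<and>
    (\<forall>u\<in>carr U. blinfun_apply g (u, 0) \<bullet> blinfun_apply g (0, 1) = 0) \<and>
    (\<forall>a\<in>orthogonal_comp (carr W). blinfun_apply x a = 0) \<and>
    (\<forall>a. x a \<in> carr V) \<and>
    (\<forall>a. \<forall>u\<in>carr U. blinfun_apply g (u, 0) \<bullet> blinfun_apply x a = 0) \<and>
    (\<forall>a. blinfun_apply g (0, 1) \<bullet> blinfun_apply x a = 0)"
proof -
  have R: "(\<forall>p\<in>carr (rep_sum U X). blinfun_apply g p \<bullet> blinfun_apply x a = 0) \<longleftrightarrow>
      (\<forall>u\<in>carr U. blinfun_apply g (u, 0) \<bullet> blinfun_apply x a = 0) \<and>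
      blinfun_apply g (0, 1) \<bullet> blinfun_apply x a = 0" (is "?L \<longleftrightarrow> ?R") for a
  proof
    assume L: ?L
    have "(0, 1) \<in> carr (rep_sum U X)" "\<And>u. u \<in> carr U \<Longrightarrow> (u, 0) \<in> carr (rep_sum U X)"
      using subspace_0[OF U] X by simp_all
    then show ?R using L by blast
  next
    assume R: ?R
    have "blinfun_apply g (u, s) \<bullet> blinfun_apply x a = 0" if "u \<in> carr U" for u s
      unfolding blinfun_Pair_split[of g u s] using R that by (simp add: inner_add_left)
    then show ?L using X by auto
  qed
  show ?thesis
    unfolding mem_gamma_bundle[OF W V] lin_iso_rep_sum_iff[OF U V X] R all_conj_distrib conj_assoc
    by (rule refl)
qed

text \<open>The bundle over \<open>L(U, V)\<close> for \<open>W \<oplus> X\<close>: a fibre vector \<open>z\<close> is a pair of a \<open>W\<close>-part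
  \<open>a \<mapsto> z(a, 0)\<close> and a single vector \<open>z(0, 1)\<close>, each orthogonal to \<open>f(U)\<close>.\<close>

lemma mem_gamma_bundle_fibre_sum:
  fixes U :: "'u::euclidean_space c2rep" and V :: "'v::euclidean_space c2rep"
    and W :: "'w::euclidean_space c2rep" and X :: "real c2rep"
  assumes V: "subspace (carr V)" and W: "subspace (carr W)" and X: "carr X = UNIV"
  shows "(f, z) \<in> gamma_bundle (rep_sum W X) U V \<longleftrightarrow>
    f \<in> lin_iso U V \<and> (\<forall>a\<in>orthogonal_comp (carr W). blinfun_apply z (a, 0) = 0) \<and>
    (\<forall>a. z (a, 0) \<in> carr V) \<and> z (0, 1) \<in> carr V \<and>
    (\<forall>a. \<forall>u\<in>carr U. blinfun_apply f u \<bullet> blinfun_apply z (a, 0) = 0) \<and>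
    (\<forall>u\<in>carr U. blinfun_apply f u \<bullet> blinfun_apply z (0, 1) = 0)"
proof -
  have WX: "subspace (carr (rep_sum W X))"
    using W X by (simp add: subspace_Times)
  have 1: "(\<forall>p\<in>orthogonal_comp (carr (rep_sum W X)). blinfun_apply z p = 0) \<longleftrightarrow>
      (\<forall>a\<in>orthogonal_comp (carr W). blinfun_apply z (a, 0) = 0)"
    by (simp add: X orthogonal_comp_Times_UNIV[OF subspace_0[OF W]])
  have "z (a, s) \<in> carr V" if "z (a, 0) \<in> carr V" "z (0, 1) \<in> carr V" for a s
    unfolding blinfun_Pair_split[of z a s] using that
    by (intro subspace_add[OF V] subspace_scale[OF V])
  then have 2: "(\<forall>p. z p \<in> carr V) \<longleftrightarrow> (\<forall>a. z (a, 0) \<in> carr V) \<and> z (0, 1) \<in> carr V"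
    unfolding split_paired_All by blast
  have "blinfun_apply f u \<bullet> blinfun_apply z (a, s) = 0"
    if "blinfun_apply f u \<bullet> blinfun_apply z (a, 0) = 0" "blinfun_apply f u \<bullet> blinfun_apply z (0, 1) = 0" for u a s
    unfolding blinfun_Pair_split[of z a s] using that by (simp add: inner_add_right)
  then have 3: "(\<forall>p. \<forall>u\<in>carr U. blinfun_apply f u \<bullet> blinfun_apply z p = 0) \<longleftrightarrow>
      (\<forall>a. \<forall>u\<in>carr U. blinfun_apply f u \<bullet> blinfun_apply z (a, 0) = 0) \<and>
      (\<forall>u\<in>carr U. blinfun_apply f u \<bullet> blinfun_apply z (0, 1) = 0)"
    unfolding split_paired_All by blast
  show ?thesis
    unfolding mem_gamma_bundle[OF WX V] 1 2 3 conj_assoc by (rule refl)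
qed

lemma mem_carr_tens_rep_line:
  fixes W :: "'w::euclidean_space c2rep" and X :: "real c2rep"
  assumes "subspace (carr W)" and "carr X = UNIV"
  shows "w \<in> carr (tens_rep W X) \<longleftrightarrow> (\<forall>a\<in>orthogonal_comp (carr W). blinfun_apply w a = 0)"
  using assms by (simp add: tens_rep_def mem_tens_space)

section \<open>Equivariance of the operations on linear maps\<close>

lemma c2_rep_adjoint:
  assumes "c2_rep U"
  shows "adjoint (act U) = act U"
proof (rule adjoint_unique, intro allI)
  fix x y
  have "act U x \<bullet> act U (act U y) = x \<bullet> act U y"
    using assms unfolding c2_rep_def orthogonal_transformation_def by blast
  then show "act U x \<bullet> y = x \<bullet> act U y"
    using assms unfolding c2_rep_def by simp
qed

lemma c2_rep_linear: "c2_rep U \<Longrightarrow> linear (act U)"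
  by (simp add: c2_rep_def orthogonal_transformation_def)

lemma c2_rep_sum:
  assumes "c2_rep U" and "c2_rep X"
  shows "c2_rep (rep_sum U X)"
  using assms unfolding c2_rep_def orthogonal_transformation_def
  by (auto simp: subspace_Times linear_iff)

lemma tens_map_act_apply:
  assumes "c2_rep W" and "c2_rep V"
  shows "blinfun_apply (tens_map (act W) (act V) t) a = act V (t (act W a))"
  using assms by (simp add: tens_map_apply c2_rep_linear c2_rep_adjoint)

lemma conj_act_apply:
  assumes "c2_rep U" and "c2_rep V"
  shows "blinfun_apply (conj_act U V f) u = act V (f (act U u))"
proof -
  have "linear (\<lambda>u. act V (f (act U u)))"
    using linear_compose[OF linear_compose[OF c2_rep_linear[OF assms(1)]
        bounded_linear.linear[OF blinfun.bounded_linear_right[of f]]] c2_rep_linear[OF assms(2)]]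
    by (simp add: o_def)
  then show ?thesis
    unfolding conj_act_def by (simp add: bounded_linear_Blinfun_apply linear_conv_bounded_linear)
qed

section \<open>Polar coordinates on the fibres\<close>

text \<open>The composition restricted to finite points, with the inclusion of \<open>W \<otimes> X\<close> substituted. Here
  \<open>g\<close> is restricted along \<open>u \<mapsto> (u, 0)\<close> on the whole ambient space, which agrees with the
  restriction along \<open>ext0\<close> because \<open>g\<close> vanishes on \<open>U\<bottom> \<times> 0\<close>.\<close>

definition join_map ::
  "((('u::euclidean_space \<times> real) \<Rightarrow>\<^sub>L 'v::euclidean_space) \<times> ('w::euclidean_space \<Rightarrow>\<^sub>L 'v)) \<times> ('w \<Rightarrow>\<^sub>L real)
    \<Rightarrow> ('u \<Rightarrow>\<^sub>L 'v) \<times> ('w \<Rightarrow>\<^sub>L 'v)" where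
  "join_map = (\<lambda>((g, x), w). (g o\<^sub>L blinfun_inl, x + ((g o\<^sub>L blinfun_inr) o\<^sub>L w)))"

definition zero_section_map ::
  "('u::euclidean_space \<Rightarrow>\<^sub>L 'v::euclidean_space) \<times> ('w::euclidean_space \<Rightarrow>\<^sub>L 'v)
    \<Rightarrow> ('u \<Rightarrow>\<^sub>L 'v) \<times> (('w \<times> real) \<Rightarrow>\<^sub>L 'v)" where
  "zero_section_map = (\<lambda>(f, x). (f, x o\<^sub>L fst_blinfun))"

text \<open>Polar coordinates in the \<open>X\<close>-part of the fibre: with \<open>v = g(0, 1)\<close>, the fibre vector has
  \<open>W\<close>-part \<open>x + w \<otimes> v\<close> and \<open>X\<close>-part \<open>t v\<close>.\<close>

definition polar_map ::
  "(((('u::euclidean_space \<times> real) \<Rightarrow>\<^sub>L 'v::euclidean_space) \<times> ('w::euclidean_space \<Rightarrow>\<^sub>L 'v)) \<times> ('w \<Rightarrow>\<^sub>L real)) \<times> real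
    \<Rightarrow> ('u \<Rightarrow>\<^sub>L 'v) \<times> (('w \<times> real) \<Rightarrow>\<^sub>L 'v)" where
  "polar_map = (\<lambda>(((g, x), w), t).
     (g o\<^sub>L blinfun_inl,
      ((x + ((g o\<^sub>L blinfun_inr) o\<^sub>L w)) o\<^sub>L fst_blinfun) + t *\<^sub>R ((g o\<^sub>L blinfun_inr) o\<^sub>L snd_blinfun)))"

lemma polar_map_0: "polar_map (p, 0) = zero_section_map (join_map p)"
  by (auto simp: polar_map_def zero_section_map_def join_map_def split: prod.splits)

lemma polar_apply:
  "blinfun_apply (snd (polar_map (((g, x), w), t))) (a, s) =
     x a + w a *\<^sub>R blinfun_apply g (0, 1) + (t * s) *\<^sub>R blinfun_apply g (0, 1)"
  by (simp add: polar_map_def blinfun.bilinear_simps blinfun_scaleR_snd[of g s]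
      blinfun_scaleR_snd[of g "blinfun_apply w a"])

lemma fst_polar: "fst (polar_map (((g, x), w), t)) = g o\<^sub>L blinfun_inl"
  by (simp add: polar_map_def)

lemma continuous_on_polar_map: "continuous_on S polar_map"
  unfolding polar_map_def split_beta by (intro continuous_intros)

lemma continuous_on_zero_section_map: "continuous_on S zero_section_map"
  unfolding zero_section_map_def split_beta by (intro continuous_intros)

lemma inj_zero_section_map: "inj zero_section_map"
proof (rule injI, clarify)
  fix f f' :: "'u::euclidean_space \<Rightarrow>\<^sub>L 'v::euclidean_space"
    and x x' :: "'w::euclidean_space \<Rightarrow>\<^sub>L 'v"
  assume "zero_section_map (f, x) = zero_section_map (f', x')"
  then have f: "f = f'" and x: "x o\<^sub>L (fst_blinfun :: ('w \<times> real) \<Rightarrow>\<^sub>L 'w) = x' o\<^sub>L fst_blinfun"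
    by (simp_all add: zero_section_map_def)
  have "x a = x' a" for a
    using arg_cong[OF x, of "\<lambda>h. blinfun_apply h (a, 0)"] by simp
  then show "f = f' \<and> x = x'"
    using f by (simp add: blinfun_eqI)
qed

locale isometry_setting =
  fixes U :: "'u::euclidean_space c2rep" and V :: "'v::euclidean_space c2rep"
    and W :: "'w::euclidean_space c2rep" and X :: "real c2rep"
  assumes U: "subspace (carr U)" and V: "subspace (carr V)" and W: "subspace (carr W)"
    and X: "carr X = UNIV"
begin

abbreviation "source \<equiv> gamma_bundle W (rep_sum U X) V \<times> carr (tens_rep W X)"

lemma sourceD:
  assumes "((g, x), w) \<in> source"
  shows "g o\<^sub>L blinfun_inl \<in> lin_iso U V" "g (0, 1) \<in> carr V" "norm (blinfun_apply g (0, 1)) = 1"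
    "\<And>u. u \<in> carr U \<Longrightarrow> blinfun_apply g (u, 0) \<bullet> blinfun_apply g (0, 1) = 0"
    "\<And>a. a \<in> orthogonal_comp (carr W) \<Longrightarrow> blinfun_apply x a = 0"
    "\<And>a. x a \<in> carr V"
    "\<And>a u. u \<in> carr U \<Longrightarrow> blinfun_apply g (u, 0) \<bullet> blinfun_apply x a = 0"
    "\<And>a. blinfun_apply g (0, 1) \<bullet> blinfun_apply x a = 0"
    "\<And>a. a \<in> orthogonal_comp (carr W) \<Longrightarrow> blinfun_apply w a = 0"
  using assms unfolding mem_Times_iff fst_conv snd_conv mem_gamma_bundle_base_sum[OF U V W X]
    mem_carr_tens_rep_line[OF W X] by blast+

lemma sourceI:
  assumes "g o\<^sub>L blinfun_inl \<in> lin_iso U V" "g (0, 1) \<in> carr V" "norm (blinfun_apply g (0, 1)) = 1"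
    "\<And>u. u \<in> carr U \<Longrightarrow> blinfun_apply g (u, 0) \<bullet> blinfun_apply g (0, 1) = 0"
    "\<And>a. a \<in> orthogonal_comp (carr W) \<Longrightarrow> blinfun_apply x a = 0"
    "\<And>a. x a \<in> carr V"
    "\<And>a u. u \<in> carr U \<Longrightarrow> blinfun_apply g (u, 0) \<bullet> blinfun_apply x a = 0"
    "\<And>a. blinfun_apply g (0, 1) \<bullet> blinfun_apply x a = 0"
    "\<And>a. a \<in> orthogonal_comp (carr W) \<Longrightarrow> blinfun_apply w a = 0"
  shows "((g, x), w) \<in> source"
  using assms unfolding mem_Times_iff fst_conv snd_conv mem_gamma_bundle_base_sum[OF U V W X]
    mem_carr_tens_rep_line[OF W X] by blast

lemma closed_carr_tens_rep: "closed (carr (tens_rep W X))"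
proof -
  have "carr (tens_rep W X) = (\<Inter>a\<in>orthogonal_comp (carr W). {w. blinfun_apply w a = 0})"
    by (auto simp: mem_carr_tens_rep_line[OF W X])
  then show ?thesis
    by (auto intro!: closed_INT closed_Collect_eq continuous_intros)
qed

lemma closed_source: "closed source"
  by (intro closed_Times closed_gamma_bundle W V closed_carr_tens_rep)

lemma zero_section_map_in:
  assumes "p \<in> gamma_bundle W U V"
  shows "zero_section_map p \<in> gamma_bundle (rep_sum W X) U V"
  using assms subspace_0[OF V] 
  by (cases p) (simp add: zero_section_map_def mem_gamma_bundle[OF W V] mem_gamma_bundle_fibre_sum[OF V W X]
      blinfun.zero_right)

lemma join_map_in:
  assumes "p \<in> source"
  shows "join_map p \<in> gamma_bundle W U V"
proof -
  obtain g x w where p: "p = ((g, x), w)" by (metis surj_pair)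
  note D = sourceD[OF assms[unfolded p]]
  have ap: "blinfun_apply (x + ((g o\<^sub>L blinfun_inr) o\<^sub>L w)) a = x a + w a *\<^sub>R blinfun_apply g (0, 1)" for a
    by (simp add: blinfun.bilinear_simps blinfun_scaleR_snd[of g "blinfun_apply w a"])
  show ?thesis
    unfolding p join_map_def prod.case mem_gamma_bundle[OF W V] ap
    using D by (auto intro: subspace_add[OF V] subspace_scale[OF V] simp: inner_add_right)
qed

lemma polar_map_in:
  assumes "p \<in> source"
  shows "polar_map (p, t) \<in> gamma_bundle (rep_sum W X) U V"
proof -
  obtain g x w where p: "p = ((g, x), w)" by (metis surj_pair)
  note D = sourceD[OF assms[unfolded p]]
  define z where "z = snd (polar_map (p, t))"
  have eq: "polar_map (p, t) = (g o\<^sub>L blinfun_inl, z)"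
    by (simp add: z_def p polar_map_def)
  have z0: "blinfun_apply z (a, 0) = x a + w a *\<^sub>R blinfun_apply g (0, 1)" for a
    unfolding z_def p polar_apply by simp
  have z1: "blinfun_apply z (0, 1) = t *\<^sub>R blinfun_apply g (0, 1)"
    unfolding z_def p polar_apply by (simp add: blinfun.zero_right)
  show ?thesis
    unfolding eq mem_gamma_bundle_fibre_sum[OF V W X] z0 z1
    using D(1,2,4-9)
    by (simp add: subspace_add[OF V] subspace_scale[OF V] inner_add_right)
qed

text \<open>As \<open>x a\<close> is orthogonal to the unit vector \<open>v\<close>, the \<open>W\<close>-part \<open>x + w \<otimes> v\<close> bounds \<open>x\<close> and
  \<open>w\<close> separately, the \<open>X\<close>-part has norm \<open>t\<close>, and \<open>g\<close> has norm at most \<open>1\<close>. Hence the polar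
  map is proper.\<close>

lemma norm_polar_map_ge:
  assumes "p \<in> source" and t: "0 \<le> t"
  shows "norm (p, t) \<le> 1 + 3 * norm (polar_map (p, t))"
proof -
  obtain g x w where p: "p = ((g, x), w)" by (metis surj_pair)
  note D = sourceD[OF assms(1)[unfolded p]]
  define z where "z = snd (polar_map (p, t))"
  let ?v = "blinfun_apply g (0, 1)"
  have z: "z (a, s) = x a + w a *\<^sub>R ?v + (t * s) *\<^sub>R ?v" for a s
    unfolding z_def p by (rule polar_apply)
  have "g \<in> lin_iso (rep_sum U X) V"
    using lin_iso_rep_sum_iff[OF U V X] D by blast
  then have g: "norm g \<le> 1"
    by (intro norm_lin_iso_le[of "rep_sum U X"]) (use U X in \<open>simp_all add: subspace_Times\<close>)
  have sq: "(norm (x a))\<^sup>2 + (w a)\<^sup>2 \<le> (norm z * norm a)\<^sup>2" for a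
  proof -
    have "orthogonal (blinfun_apply x a) (w a *\<^sub>R ?v)"
      using D(8)[of a] by (simp add: orthogonal_def inner_commute)
    then have "(norm (z (a, 0)))\<^sup>2 = (norm (x a))\<^sup>2 + (norm (w a *\<^sub>R ?v))\<^sup>2"
      using norm_add_Pythagorean[of "blinfun_apply x a" "w a *\<^sub>R ?v"] by (simp add: z)
    then have "(norm (x a))\<^sup>2 + (w a)\<^sup>2 = (norm (z (a, 0)))\<^sup>2"
      using D(3) by simp
    also have "\<dots> \<le> (norm z * norm (a, 0::real))\<^sup>2"
      by (intro power_mono norm_blinfun) simp
    finally show ?thesis by (simp add: norm_Pair)
  qed
  have x: "norm x \<le> norm z"
  proof (rule norm_blinfun_bound)
    fix a
    have "(norm (x a))\<^sup>2 \<le> (norm z * norm a)\<^sup>2"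
      using sq[of a] zero_le_power2[of "blinfun_apply w a"] by linarith
    then show "norm (x a) \<le> norm z * norm a"
      by (rule power2_le_imp_le) simp
  qed simp
  have w: "norm w \<le> norm z"
  proof (rule norm_blinfun_bound)
    fix a
    have "(norm (w a))\<^sup>2 \<le> (norm z * norm a)\<^sup>2"
      using sq[of a] zero_le_power2[of "norm (blinfun_apply x a)"] unfolding real_norm_def power2_abs by linarith
    then show "norm (w a) \<le> norm z * norm a"
      by (rule power2_le_imp_le) simp
  qed simp
  have "norm (z (0, 1)) \<le> norm z * norm (0 :: 'w, 1 :: real)"
    by (rule norm_blinfun)
  moreover have "norm (z (0, 1)) = t"
    using D(3) t by (simp add: z blinfun.zero_right)
  ultimately have t_le: "t \<le> norm z"
    by (simp add: norm_Pair)
  have "norm (p, t) \<le> norm g + norm x + norm w + t"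
    using norm_Pair_le[of p t] norm_Pair_le[of "(g, x)" w] norm_Pair_le[of g x] t by (simp add: p)
  moreover have "norm z \<le> norm (polar_map (p, t))"
    unfolding z_def by (metis norm_snd_le prod.collapse)
  ultimately show ?thesis
    using g x w t_le by linarith
qed

text \<open>The bound that makes the zero section proper; the constant term \<open>0\<close> gives it the form used in
  \<open>compactin_preimage_of_norm_bound\<close>.\<close>

lemma norm_zero_section_map_ge:
  fixes p :: "('u \<Rightarrow>\<^sub>L 'v) \<times> ('w \<Rightarrow>\<^sub>L 'v)"
  shows "norm p \<le> 0 + 2 * norm (zero_section_map p)"
proof -
  obtain f x where p: "p = (f, x)" by (metis surj_pair)
  let ?z = "x o\<^sub>L (fst_blinfun :: ('w \<times> real) \<Rightarrow>\<^sub>L 'w)"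
  have "norm x \<le> norm ?z"
  proof (rule norm_blinfun_bound)
    fix a
    show "norm (x a) \<le> norm ?z * norm a"
      using norm_blinfun[of ?z "(a, 0)"] by (simp add: norm_Pair)
  qed simp
  moreover have "norm ?z \<le> norm (zero_section_map p)" "norm f \<le> norm (zero_section_map p)"
    unfolding p zero_section_map_def prod.case by (rule norm_snd_le, rule norm_fst_le)
  ultimately show ?thesis
    using norm_Pair_le[of f x] by (simp add: p)
qed

text \<open>The \<open>X\<close>-part \<open>t v\<close> of the image has norm \<open>t\<close>, so for \<open>t > 0\<close> it determines \<open>t\<close> and \<open>v\<close>, hence
  \<open>g\<close>; the inner product of the \<open>W\<close>-part with \<open>v\<close> is then \<open>w\<close>, and what remains is \<open>x\<close>.\<close>

lemma inj_on_polar_map: "inj_on polar_map (source \<times> {0<..})"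
proof (rule inj_onI)
  fix d d' :: "(((('u \<times> real) \<Rightarrow>\<^sub>L 'v) \<times> ('w \<Rightarrow>\<^sub>L 'v)) \<times> ('w \<Rightarrow>\<^sub>L real)) \<times> real"
  assume d: "d \<in> source \<times> {0<..}" and d': "d' \<in> source \<times> {0<..}" and eq: "polar_map d = polar_map d'"
  obtain g x w t where d_eq: "d = (((g, x), w), t)" by (metis surj_pair)
  obtain g' x' w' t' where d'_eq: "d' = (((g', x'), w'), t')" by (metis surj_pair)
  have s: "((g, x), w) \<in> source" "0 < t" "((g', x'), w') \<in> source" "0 < t'"
    using d d' unfolding d_eq d'_eq by simp_all
  note D = sourceD[OF s(1)] and D' = sourceD[OF s(3)]
  have f: "g o\<^sub>L blinfun_inl = g' o\<^sub>L blinfun_inl"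
    using arg_cong[OF eq, of fst] unfolding d_eq d'_eq fst_polar .
  have z: "x a + w a *\<^sub>R blinfun_apply g (0, 1) + (t * s) *\<^sub>R blinfun_apply g (0, 1) =
      x' a + w' a *\<^sub>R blinfun_apply g' (0, 1) + (t' * s) *\<^sub>R blinfun_apply g' (0, 1)" for a s
    using arg_cong[OF eq, of "\<lambda>q. blinfun_apply (snd q) (a, s)"] unfolding d_eq d'_eq polar_apply .
  have tv: "t *\<^sub>R blinfun_apply g (0, 1) = t' *\<^sub>R blinfun_apply g' (0, 1)"
    using z[of 0 1] by (simp add: blinfun.zero_right)
  have t: "t = t'"
    using arg_cong[OF tv, of norm] D(3) D'(3) s by simp
  then have v: "blinfun_apply g (0, 1) = blinfun_apply g' (0, 1)"
    using tv s by simp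
  have g: "g = g'"
  proof (rule blinfun_eqI, clarify)
    fix u s
    show "blinfun_apply g (u, s) = blinfun_apply g' (u, s)"
      unfolding blinfun_Pair_split[of g u s] blinfun_Pair_split[of g' u s] v
      using arg_cong[OF f, of "\<lambda>h. blinfun_apply h u"] by simp
  qed
  have xw: "x a + w a *\<^sub>R blinfun_apply g (0, 1) = x' a + w' a *\<^sub>R blinfun_apply g (0, 1)" for a
    using z[of a 0] by (simp add: v)
  have w: "w a = w' a" for a
  proof -
    have "blinfun_apply g (0, 1) \<bullet> blinfun_apply g (0, 1) = 1"
      using D(3) by (simp add: norm_eq_1)
    then show ?thesis
      using arg_cong[OF xw[of a], of "\<lambda>y. blinfun_apply g (0, 1) \<bullet> y"] D(8)[of a] D'(8)[of a]
      by (simp add: inner_add_right g)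
  qed
  then have "x a = x' a" for a
    using xw[of a] by simp
  then have "x = x'" "w = w'"
    using w by (simp_all add: blinfun_eqI)
  then show "d = d'"
    using g t by (simp add: d_eq d'_eq)
qed

lemma polar_map_disjoint:
  "zero_section_map ` gamma_bundle W U V \<inter> polar_map ` (source \<times> {0<..}) = {}"
proof -
  have False if "p \<in> source" "0 < t" "polar_map (p, t) = zero_section_map q" for p t q
  proof -
    obtain g x w where p: "p = ((g, x), w)" by (metis surj_pair)
    note D = sourceD[OF that(1)[unfolded p]]
    have "blinfun_apply (snd (polar_map (p, t))) (0, 1) = t *\<^sub>R blinfun_apply g (0, 1)"
      unfolding p polar_apply by (simp add: blinfun.zero_right)
    moreover have "blinfun_apply (snd (zero_section_map q)) (0, 1) = 0"
      by (cases q) (simp add: zero_section_map_def blinfun.zero_right)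
    ultimately have "t *\<^sub>R blinfun_apply g (0, 1) = 0"
      using that(3) by simp
    then show False
      using that(2) D(3) by auto
  qed
  then show ?thesis
    by (fastforce simp: disjoint_iff)
qed

text \<open>A fibre vector with nonzero \<open>X\<close>-part \<open>y\<close> has polar coordinates \<open>t = |y|\<close>, \<open>v = y / t\<close>; splitting its
  \<open>W\<close>-part into the component along \<open>v\<close> and the rest gives \<open>w\<close> and \<open>x\<close>.\<close>

lemma polar_map_cover:
  "gamma_bundle (rep_sum W X) U V \<subseteq>
     zero_section_map ` gamma_bundle W U V \<union> polar_map ` (source \<times> {0<..})"
proof
  fix q assume q: "q \<in> gamma_bundle (rep_sum W X) U V"
  obtain f z where q_eq: "q = (f, z)" by (metis surj_pair)
  note Q = q[unfolded q_eq mem_gamma_bundle_fibre_sum[OF V W X]]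
  show "q \<in> zero_section_map ` gamma_bundle W U V \<union> polar_map ` (source \<times> {0<..})"
  proof (cases "blinfun_apply z (0, 1) = 0")
    case True
    have "zero_section_map (f, z o\<^sub>L blinfun_inl) = q"
    proof -
      have "blinfun_apply z (a, 0) = blinfun_apply z (a, s)" for a s
        using blinfun_Pair_split[of z a s] True by simp
      then have "(z o\<^sub>L blinfun_inl) o\<^sub>L fst_blinfun = z"
        by (intro blinfun_eqI) auto
      then show ?thesis
        by (simp add: zero_section_map_def q_eq)
    qed
    moreover have "(f, z o\<^sub>L blinfun_inl) \<in> gamma_bundle W U V"
      unfolding mem_gamma_bundle[OF W V] using Q by simp
    ultimately show ?thesis by blast
  next
    case False
    define t where "t = norm (z (0, 1))"
    define v where "v = (1 / t) *\<^sub>R z (0, 1)"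
    have t: "0 < t"
      using False by (simp add: t_def)
    have v: "norm v = 1" "t *\<^sub>R v = z (0, 1)"
      using t False by (simp_all add: v_def) (simp add: t_def)
    have vV: "v \<in> carr V"
      unfolding v_def using Q by (intro subspace_scale[OF V]) blast
    have vv: "v \<bullet> v = 1" using v(1) by (simp add: norm_eq_1)
    have fv: "blinfun_apply f u \<bullet> v = 0" if "u \<in> carr U" for u
      using Q that by (simp add: v_def)
    define g :: "('u \<times> real) \<Rightarrow>\<^sub>L 'v" where
      "g = (f o\<^sub>L fst_blinfun) + (blinfun_scaleR_left v o\<^sub>L snd_blinfun)"
    define w :: "'w \<Rightarrow>\<^sub>L real" where
      "w = (blinfun_inner_left v o\<^sub>L z) o\<^sub>L blinfun_inl"
    define x :: "'w \<Rightarrow>\<^sub>L 'v" where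
      "x = (z o\<^sub>L blinfun_inl) - (blinfun_scaleR_left v o\<^sub>L w)"
    have g: "blinfun_apply g (u, s) = f u + s *\<^sub>R v" for u s
      by (simp add: g_def blinfun.bilinear_simps)
    have w: "blinfun_apply w a = z (a, 0) \<bullet> v" for a
      by (simp add: w_def)
    have x: "blinfun_apply x a = z (a, 0) - w a *\<^sub>R v" for a
      by (simp add: x_def blinfun.bilinear_simps)
    have gf: "g o\<^sub>L blinfun_inl = f"
      by (rule blinfun_eqI) (simp add: g)
    have g01: "blinfun_apply g (0, 1) = v" and gu0: "blinfun_apply g (u, 0) = f u" for u
      by (simp_all add: g blinfun.zero_right)
    have "((g, x), w) \<in> source"
    proof (rule sourceI, unfold gf g01 gu0)
      show "blinfun_apply w a = 0" if "a \<in> orthogonal_comp (carr W)" for a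
        using Q that by (simp add: w)
      then show "blinfun_apply x a = 0" if "a \<in> orthogonal_comp (carr W)" for a
        using Q that by (simp add: x)
      show "x a \<in> carr V" for a
        unfolding x using Q vV by (intro subspace_diff[OF V] subspace_scale[OF V]) blast+
      show "blinfun_apply f u \<bullet> blinfun_apply x a = 0" if "u \<in> carr U" for a u
        using Q that fv[OF that] by (simp add: x inner_diff_right)
      show "v \<bullet> blinfun_apply x a = 0" for a
        using vv by (simp add: x w inner_diff_right inner_commute)
      show "f \<in> lin_iso U V" using Q by blast
      show "v \<in> carr V" by (rule vV)
      show "norm v = 1" by (rule v(1))
      show "blinfun_apply f u \<bullet> v = 0" if "u \<in> carr U" for u using that by (rule fv)
    qed
    moreover have "polar_map (((g, x), w), t) = q"
    proof -
      have "snd (polar_map (((g, x), w), t)) = z"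
      proof (rule blinfun_eqI, clarify)
        fix a s
        show "blinfun_apply (snd (polar_map (((g, x), w), t))) (a, s) = blinfun_apply z (a, s)"
          unfolding polar_apply g01 blinfun_Pair_split[of z a s] v(2)[symmetric] by (simp add: x mult.commute)
      qed
      moreover have "fst (polar_map (((g, x), w), t)) = f"
        unfolding fst_polar by (rule gf)
      ultimately show ?thesis
        by (simp add: q_eq prod_eq_iff)
    qed
    ultimately have "q \<in> polar_map ` (source \<times> {0<..})"
      using t by (intro image_eqI[of q polar_map "(((g, x), w), t)"]) simp_all
    then show ?thesis ..
  qed
qed

end

section \<open>The cofibre sequence\<close>

text \<open>The sign of the action on \<open>X\<close> enters both \<open>v = g(0, 1)\<close> and \<open>w\<close>, and cancels in \<open>w \<otimes> v\<close>; in
  \<open>t v\<close> it is the action on the \<open>X\<close>-part of \<open>W \<oplus> X\<close>, so the parameter \<open>t\<close> is fixed.\<close>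

lemma polar_map_equivariant:
  fixes U :: "'u::euclidean_space c2rep" and V :: "'v::euclidean_space c2rep"
    and W :: "'w::euclidean_space c2rep" and X :: "real c2rep"
  assumes U: "c2_rep U" and V: "c2_rep V" and W: "c2_rep W" and X: "c2_rep X"
  shows "polar_map ((map_prod (conj_act (rep_sum U X) V) (tens_map (act W) (act V)) p, tens_map (act W) (act X) w), t) =
    map_prod (conj_act U V) (tens_map (act (rep_sum W X)) (act V)) (polar_map ((p, w), t))"
proof -
  obtain g x where p: "p = (g, x)" by (metis surj_pair)
  note apply_simps = conj_act_apply[OF U V] conj_act_apply[OF c2_rep_sum[OF U X] V, unfolded act_rep_sum]
    tens_map_act_apply[OF W V] tens_map_act_apply[OF W X] tens_map_act_apply[OF c2_rep_sum[OF W X] V, unfolded act_rep_sum]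
  have lin: "linear (act U)" "linear (act V)" "linear (act X)"
    using assms by (simp_all add: c2_rep_linear)
  have inv: "act X (act X r) = r" for r
    using X by (simp add: c2_rep_def)
  show ?thesis
    unfolding p polar_map_def map_prod_simp prod.case prod.inject
  proof (intro conjI blinfun_eqI, goal_cases)
    case (1 u)
    show ?case
      by (simp add: apply_simps linear_0[OF lin(3)])
  next
    case (2 y)
    show ?case
      by (cases y) (simp add: apply_simps blinfun.bilinear_simps linear_0[OF lin(1)]
          linear_add[OF lin(2)] linear_scale[OF lin(2)] inv)
  qed
qed

lemma zero_section_map_equivariant:
  fixes U :: "'u::euclidean_space c2rep" and V :: "'v::euclidean_space c2rep"
    and W :: "'w::euclidean_space c2rep" and X :: "real c2rep"
  assumes V: "c2_rep V" and W: "c2_rep W" and X: "c2_rep X"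
  shows "zero_section_map (map_prod (conj_act U V) (tens_map (act W) (act V)) q) =
    map_prod (conj_act U V) (tens_map (act (rep_sum W X)) (act V)) (zero_section_map q)"
proof -
  obtain f x where q: "q = (f, x)" by (metis surj_pair)
  have "tens_map (act W) (act V) x o\<^sub>L fst_blinfun = tens_map (act (rep_sum W X)) (act V) (x o\<^sub>L fst_blinfun)"
    by (rule blinfun_eqI) (simp add: tens_map_act_apply[OF W V] tens_map_act_apply[OF c2_rep_sum[OF W X] V, unfolded act_rep_sum])
  then show ?thesis
    by (simp add: q zero_section_map_def)
qed

lemma ext0_apply:
  fixes f :: "'u::euclidean_space \<Rightarrow> 'v::euclidean_space"
  assumes S: "subspace S" and f: "linear f"
  shows "u \<in> S \<Longrightarrow> blinfun_apply (ext0 S f) u = f u"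
    and "u \<in> orthogonal_comp S \<Longrightarrow> blinfun_apply (ext0 S f) u = 0"
  using theI'[OF ext0_unique_exists[OF S f]] unfolding ext0_def[symmetric] by blast+

text \<open>On finite points the composition is \<open>join_map\<close>: \<open>g\<close> vanishes on \<open>U\<bottom> \<times> 0\<close>, so extending the
  inclusion \<open>U \<rightarrow> U \<oplus> X\<close> by zero does not change the composite.\<close>

lemma J_comp_sphere_incl:
  fixes U :: "'u::euclidean_space c2rep" and V :: "'v::euclidean_space c2rep" 
    and x :: "'w::euclidean_space \<Rightarrow>\<^sub>L 'v" and w :: "'w \<Rightarrow>\<^sub>L real" and X :: "real c2rep"
  assumes U: "subspace (carr U)" and V: "subspace (carr V)" and X: "carr X = UNIV"
    and g: "g \<in> lin_iso (rep_sum U X) V"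
  shows "J_comp (Some (g, x)) (sphere_incl U (Some w)) = Some (join_map ((g, x), w))"
proof -
  have l: "linear (\<lambda>u::'u. (u, 0::real))" "linear (\<lambda>y::real. (0::'u, y))"
    by (auto intro!: linearI)
  have g0: "blinfun_apply g (u, 0) = 0" if "u \<in> orthogonal_comp (carr U)" for u
    using g that unfolding lin_iso_rep_sum_iff[OF U V X] by (simp add: lin_iso_def)
  have "g o\<^sub>L ext0 (carr U) (\<lambda>u. (u, 0)) = g o\<^sub>L blinfun_inl"
  proof (rule blinfun_eqI)
    fix u
    obtain a b where u: "a \<in> carr U" "b \<in> orthogonal_comp (carr U)" "u = a + b"
      using U by (rule orthogonal_decomposition)
    have "blinfun_apply (ext0 (carr U) (\<lambda>u. (u, 0::real))) u = (a, 0)"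
      unfolding u(3) blinfun.add_right ext0_apply(1)[OF U l(1) u(1)] ext0_apply(2)[OF U l(1) u(2)] by simp
    moreover have "blinfun_apply g (u, 0) = blinfun_apply g (a, 0)"
      using blinfun.add_right[of g "(a, 0)" "(b, 0)"] g0[OF u(2)] by (simp add: u(3))
    ultimately show "blinfun_apply (g o\<^sub>L ext0 (carr U) (\<lambda>u. (u, 0))) u = blinfun_apply (g o\<^sub>L blinfun_inl) u"
      by simp
  qed
  moreover have "tens_map (\<lambda>w. w) (blinfun_apply g) (tens_map (\<lambda>w. w) (\<lambda>y. (0, y)) w) =
      (g o\<^sub>L blinfun_inr) o\<^sub>L w"
  proof (rule blinfun_eqI)
    fix a
    have "adjoint (\<lambda>w::'w. w) = (\<lambda>w. w)"
      by (rule adjoint_unique) simp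
    then show "blinfun_apply (tens_map (\<lambda>w. w) (blinfun_apply g) (tens_map (\<lambda>w. w) (\<lambda>y. (0, y)) w)) a =
        blinfun_apply ((g o\<^sub>L blinfun_inr) o\<^sub>L w) a"
      by (simp add: tens_map_apply linear_ident l bounded_linear.linear[OF blinfun.bounded_linear_right])
  qed
  ultimately show ?thesis
    by (simp add: J_comp_def sphere_incl_def join_map_def)
qed

lemma J_eq_Alexandroff_c2:
  "J W U V = Alexandroff_c2 (top_of_set (gamma_bundle W U V))
     (map_prod (conj_act U V) (tens_map (act W) (act V)))"
  by (simp add: J_def Alexandroff_c2_def)

lemma rep_sphere_eq_Alexandroff_c2:
  "rep_sphere (tens_rep W X) =
     Alexandroff_c2 (top_of_set (carr (tens_rep W X))) (tens_map (act W) (act X))"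
  by (simp add: rep_sphere_def Alexandroff_c2_def tens_rep_def)

lemma restricted_comp_eq_class:
  "restricted_comp U (eq_class (smash_rel (Alexandroff_c2 P \<alpha>) (Alexandroff_c2 B \<beta>)) (p, q)) =
     J_comp p (sphere_incl U q)"
proof -
  have "(\<lambda>(p, q). J_comp p (sphere_incl U q)) y = (\<lambda>(p, q). J_comp p (sphere_incl U q)) y'"
    if "(y, y') \<in> smash_rel (Alexandroff_c2 P \<alpha>) (Alexandroff_c2 B \<beta>)" for y y'
    using that by (auto simp: smash_rel_def J_comp_def sphere_incl_def split: option.splits)
  then show ?thesis
    unfolding restricted_comp_def by (subst the_elem_image_eq_class) auto
qed

theorem propositionD:
  fixes U :: "'u::euclidean_space c2rep"
    and V :: "'v::euclidean_space c2rep"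
    and W :: "'w::euclidean_space c2rep"
    and X :: "real c2rep"
  assumes "c2_rep U" and "c2_rep V" and "c2_rep W"
    and "X = triv_rep \<or> X = sign_rep"
  shows "c2_homeomorphic
           (mapping_cone (smash (J W (rep_sum U X) V) (rep_sphere (tens_rep W X)))
                         (J W U V)
                         (restricted_comp U))
           (J (rep_sum W X) U V)"
proof -
  have cX: "carr X = UNIV" and rX: "c2_rep X"
    using assms(4) by (auto simp: triv_rep_def sign_rep_def c2_rep_def orthogonal_transformation_def
        linear_iff)
  interpret isometry_setting U V W X
    using assms cX by unfold_locales (simp_all add: c2_rep_def)
  have WX: "subspace (carr (rep_sum W X))"
    using W X by (simp add: subspace_Times)
  have D: "prod_topology (prod_topology (top_of_set (gamma_bundle W (rep_sum U X) V))
      (top_of_set (carr (tens_rep W X)))) (top_of_set {0::real..}) = top_of_set (source \<times> {0..})"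
    by simp
  have closed_B: "closed (carr (tens_rep W X))"
    using closed_carr_tens_rep .
  show ?thesis
    unfolding J_eq_Alexandroff_c2 rep_sphere_eq_Alexandroff_c2
  proof (rule mapping_cone_smash_Alexandroff[where \<phi> = polar_map and \<psi> = zero_section_map and \<kappa> = join_map],
      unfold D)
    show "Hausdorff_space (Alexandroff_compactification (top_of_set (gamma_bundle W (rep_sum U X) V)))"
      "Hausdorff_space (Alexandroff_compactification (top_of_set (carr (tens_rep W X))))"
      "Hausdorff_space (Alexandroff_compactification (top_of_set (gamma_bundle W U V)))"
      "Hausdorff_space (Alexandroff_compactification (top_of_set (gamma_bundle (rep_sum W X) U V)))"
      by (intro Hausdorff_Alexandroff_closed closed_gamma_bundle W V WX closed_B)+
    show "continuous_map (top_of_set (source \<times> {0..})) (top_of_set (gamma_bundle (rep_sum W X) U V)) polar_map"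
      using polar_map_in by (auto simp: continuous_on_polar_map simp del: mem_Sigma_iff)
    show "continuous_map (top_of_set (gamma_bundle W U V)) (top_of_set (gamma_bundle (rep_sum W X) U V)) zero_section_map"
      using zero_section_map_in by (auto simp: continuous_on_zero_section_map)
    fix C :: "(('u \<Rightarrow>\<^sub>L 'v) \<times> (('w \<times> real) \<Rightarrow>\<^sub>L 'v)) set"
    assume C: "compactin (top_of_set (gamma_bundle (rep_sum W X) U V)) C"
    show "compactin (top_of_set (source \<times> {0..})) {d \<in> topspace (top_of_set (source \<times> {0..})). polar_map d \<in> C}"
    proof (rule compactin_preimage_of_norm_bound[OF _ continuous_on_polar_map _ _ C])
      show "closed (source \<times> {0::real..})"
        by (rule closed_Times[OF closed_source]) simp
      show "norm d \<le> 1 + 3 * norm (polar_map d)" if "d \<in> source \<times> {0..}" for d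
        using norm_polar_map_ge[of "fst d" "snd d"] that by (simp add: mem_Times_iff)
    qed simp
    show "compactin (top_of_set (gamma_bundle W U V)) {y \<in> topspace (top_of_set (gamma_bundle W U V)). zero_section_map y \<in> C}"
      by (rule compactin_preimage_of_norm_bound[OF closed_gamma_bundle[OF W V]
            continuous_on_zero_section_map norm_zero_section_map_ge _ C]) simp
  next
    fix p b assume "p \<in> topspace (top_of_set (gamma_bundle W (rep_sum U X) V))"
      "b \<in> topspace (top_of_set (carr (tens_rep W X)))"
    then have pb: "(p, b) \<in> source" by simp
    show "join_map (p, b) \<in> topspace (top_of_set (gamma_bundle W U V)) \<and>
        zero_section_map (join_map (p, b)) = polar_map ((p, b), 0)"
      using join_map_in[OF pb] by (simp add: polar_map_0)
    obtain g x where p: "p = (g, x)" by (metis surj_pair)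
    have "g \<in> lin_iso (rep_sum U X) V"
      using pb by (simp add: p gamma_bundle_def)
    from J_comp_sphere_incl[OF U V X this] show "restricted_comp U (eq_class (smash_rel
        (Alexandroff_c2 (top_of_set (gamma_bundle W (rep_sum U X) V))
          (map_prod (conj_act (rep_sum U X) V) (tens_map (act W) (act V))))
        (Alexandroff_c2 (top_of_set (carr (tens_rep W X))) (tens_map (act W) (act X)))) (Some p, Some b)) =
        Some (join_map (p, b))"
      unfolding restricted_comp_eq_class p .
    show "polar_map ((map_prod (conj_act (rep_sum U X) V) (tens_map (act W) (act V)) p,
          tens_map (act W) (act X) b), t) =
        map_prod (conj_act U V) (tens_map (act (rep_sum W X)) (act V)) (polar_map ((p, b), t))" for t
      by (rule polar_map_equivariant) (fact assms rX)+
  next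
    show "restricted_comp U (eq_class (smash_rel
        (Alexandroff_c2 (top_of_set (gamma_bundle W (rep_sum U X) V))
          (map_prod (conj_act (rep_sum U X) V) (tens_map (act W) (act V))))
        (Alexandroff_c2 (top_of_set (carr (tens_rep W X))) (tens_map (act W) (act X)))) (None, None)) = None"
      unfolding restricted_comp_eq_class by (simp add: J_comp_def)
    show "inj_on zero_section_map (topspace (top_of_set (gamma_bundle W U V)))"
      using inj_zero_section_map by (rule inj_on_subset) simp
    show "zero_section_map (map_prod (conj_act U V) (tens_map (act W) (act V)) y) =
        map_prod (conj_act U V) (tens_map (act (rep_sum W X)) (act V)) (zero_section_map y)" for y
      by (rule zero_section_map_equivariant) (fact assms rX)+
  qed (simp_all only: topspace_euclidean_subtopology inj_on_polar_map polar_map_disjoint polar_map_cover)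
qed

end
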